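(* Let $(\omega^1,\eta^1)$ and $(\omega^2,\eta^2)$ be two Nash equilibria of the relaxed mean-field game. Then the set of points $t\in[0,T]$ such that $P_t(\omega^1_t,\eta^1_t)\neq P_t(\omega^2_t,\eta^2_t)$ has Lebesgue measure zero.
   Context: Fix a horizon $T>0$, a discount rate $\rho>0$, a price cap $\overline P>0$, constants $k,\theta,\delta>0$, $\bar k,\bar\delta>0$, $\bar\theta\in(0,1)$, nonnegative constants $\kappa_C,K_C,\gamma_C,\kappa_R,K_R,\gamma_R$, and a deterministic measurable demand $\overline D:[0,T]\to\mathbb R$. State spaces and generators. $\Omega=[0,\infty)$ is the state space of the CIR process $dC_t=k(\theta-C_t)dt+\delta\sqrt{C_t}\,dW_t$, with generator $\mathcal L f(x)=k(\theta-x)f'(x)+\frac{\delta^2x}{2}f''(x)$. $\overline\Omega=[0,1]$ is the state space of the Jacobi process $dS_t=\bar k(\bar\theta-S_t)dt+\bar\delta\sqrt{S_t(1-S_t)}\,d\overline W_t$, with generator $\overline{\mathcal L}f(x)=\bar k(\bar\theta-x)f'(x)+\frac{\bar\delta^2x(1-x)}{2}f''(x)$. ($\overline\Omega$ is a separate space, not the closure of $\Omega$.) Initial data. $\omega_0$ and $\eta_0$ are finite positive Borel measures on $\Omega$ and $\overline\Omega$. $(\bar\eta_t)_{0\le t\le T}$ is the distribution of the outputs of all potential renewable projects: $\bar\eta_t(A)=\int_{\overline\Omega}\mathbb P(S^{x}_t\in A)\,\eta_0(dx)$, where $S^x$ is the Jacobi process started at $x$. Flows of measures. $V_\Omega$ is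 the space of flows $(m_t)_{0\le t\le T}$ of signed bounded measures on $\Omega$ such that $t\mapsto m_t(A)$ is measurable for every Borel $A\subset\Omega$ and $m_t(dx)\,dt$ is a finite measure on $[0,T]\times\Omega$; flows equal for almost every $t$ are identified. $V_{\overline\Omega}$ is defined in the same way. $\mathcal A(\omega_0)$ is the set of flows of positive bounded measures $(\hat\omega_t)\in V_\Omega$ such that $$\int_\Omega u(0,x)\,\omega_0(dx)+\int_0^T\!\!\int_\Omega\Big\{\frac{\partial u}{\partial t}+\mathcal Lu\Big\}\hat\omega_t(dx)\,dt\ge0$$ for all $u\ge0$, $u\in C^{1,2}([0,T]\times\Omega)$ with $\frac{\partial u}{\partial t}+\mathcal Lu$ bounded. $\overline{\mathcal A}(\eta_0)\subset V_{\overline\Omega}$ is defined in the same way with $\Omega,\mathcal L,\omega_0$ replaced by $\overline\Omega,\overline{\mathcal L},\eta_0$. Supply and gain functions. $c:[0,1]\to[0,\infty)$ is a strictly increasing continuous function with $c(0)=0$, smooth on $(0,1)$. $F:\mathbb R\to[0,1]$ is the inverse of $c$ on $[0,c(1)]$, extended by $F(y)=0$ for $y\le0$ and $F(y)=1$ for $y\ge c(1)$; $F$ is assumed to be smooth and increasing on $\mathbb R$, with $F(y)>0$ for $y>0$. $G(x)=\int_0^xF(z)\,dz$. $F_0:[0,\infty)\to[0,\infty)$ is increasing with $F_0(0)=0$ and there is $c_0>0$ with $F_0(p+h)-F_0(p)\ge c_0h$ for all $p,h\ge0$. Moreover $$f_C(t)=-\kappa_C-e^{-\gamma_Ct}K_C(\rho+\gamma_C),\qquad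 f_R(t)=\kappa_R+\rho K_R+\gamma_RK_Re^{-(\rho+\gamma_R)(T-t)}.$$ Price. For $\omega\in\mathcal A(\omega_0)$, $\eta\in\overline{\mathcal A}(\eta_0)$, with $R_t=\int_{\overline\Omega}x\,(\bar\eta_t(dx)-\eta_t(dx))$ and $z^+=\max(z,0)$, $$P_t(\omega_t,\eta_t)=\inf\Big\{P\ge0:\ (\overline D_t-R_t)^+\le\int_\Omega F(P-x)\,\omega_t(dx)+F_0(P)\Big\}\wedge\overline P,\qquad \inf\emptyset=+\infty.$$ Nash equilibrium. A Nash equilibrium of the relaxed mean-field game is a couple $(\omega^*,\eta^* )\in\mathcal A(\omega_0)\times\overline{\mathcal A}(\eta_0)$ such that for every $\omega\in\mathcal A(\omega_0)$ $$\int_0^T\!\!\int_{\Omega} e^{-\rho t}[G(P_t(\omega^*_t,\eta^*_t)-x)+f_C(t)]\,\omega_t(dx)\,dt\le\int_0^T\!\!\int_{\Omega} e^{-\rho t}[G(P_t(\omega^*_t,\eta^*_t)-x)+f_C(t)]\,\omega^*_t(dx)\,dt,$$ and for every $\eta\in\overline{\mathcal A}(\eta_0)$ $$\int_0^T\!\!\int_{\overline\Omega} e^{-\rho t}[-P_t(\omega^*_t,\eta^*_t)x+f_R(t)]\,\eta_t(dx)\,dt\le\int_0^T\!\!\int_{\overline\Omega} e^{-\rho t}[-P_t(\omega^*_t,\eta^*_t)x+f_R(t)]\,\eta^*_t(dx)\,dt.$$ *)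

theory Defs
  imports "HOL-Probability.Probability"
begin

section \<open>Brownian motion, Ito integral, Jacobi process\<close>

(* Only the indices t >= 0 of the filtration matter; a filtration on [0,oo) is extended to
   negative indices by its value at 0. All processes have continuous paths everywhere (not only
   almost surely), which keeps the path functionals below measurable. *)
definition brownian_motion ::
  "'w measure \<Rightarrow> (real \<Rightarrow> 'w measure) \<Rightarrow> (real \<Rightarrow> 'w \<Rightarrow> real) \<Rightarrow> bool" where
  "brownian_motion M Fl W \<longleftrightarrow>
     prob_space M \<and> filtration (space M) Fl \<and> (\<forall>t. subalgebra M (Fl t)) \<and>
     (\<forall>t\<ge>0. W t \<in> borel_measurable (Fl t)) \<and>
     (AE w in M. W 0 w = 0) \<and>
     (\<forall>w\<in>space M. continuous_on {0..} (\<lambda>t. W t w)) \<and>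
     (\<forall>s t. 0 \<le> s \<and> s < t \<longrightarrow>
        distributed M lborel (\<lambda>w. W t w - W s w) (normal_density 0 (sqrt (t - s))) \<and>
        prob_space.indep_set M (sets (Fl s))
          {(\<lambda>w. W t w - W s w) -` B \<inter> space M | B. B \<in> sets borel})"

(* The simple process sum_{i<n} xi_i 1_{(tau_i, tau_(i+1)]}. *)
definition simple_process ::
  "(real \<Rightarrow> 'w measure) \<Rightarrow> nat \<Rightarrow> (nat \<Rightarrow> real) \<Rightarrow> (nat \<Rightarrow> 'w \<Rightarrow> real) \<Rightarrow> bool" where
  "simple_process Fl n \<tau> \<xi> \<longleftrightarrow>
     0 \<le> \<tau> 0 \<and>
     (\<forall>i<n. \<tau> i \<le> \<tau> (Suc i) \<and> \<xi> i \<in> borel_measurable (Fl (\<tau> i)) \<and>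
            (\<exists>b. \<forall>w\<in>space (Fl (\<tau> i)). \<bar>\<xi> i w\<bar> \<le> b))"

definition simple_value ::
  "nat \<Rightarrow> (nat \<Rightarrow> real) \<Rightarrow> (nat \<Rightarrow> 'w \<Rightarrow> real) \<Rightarrow> real \<Rightarrow> 'w \<Rightarrow> real" where
  "simple_value n \<tau> \<xi> s w = (\<Sum>i<n. \<xi> i w * indicator {\<tau> i<..\<tau> (Suc i)} s)"

definition simple_integral ::
  "(real \<Rightarrow> 'w \<Rightarrow> real) \<Rightarrow> nat \<Rightarrow> (nat \<Rightarrow> real) \<Rightarrow> (nat \<Rightarrow> 'w \<Rightarrow> real) \<Rightarrow> real \<Rightarrow> 'w \<Rightarrow> real" where
  "simple_integral W n \<tau> \<xi> t w =
     (\<Sum>i<n. \<xi> i w * (W (min (\<tau> (Suc i)) t) w - W (min (\<tau> i) t) w))"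

definition null_in_probability :: "'w measure \<Rightarrow> (nat \<Rightarrow> 'w \<Rightarrow> ennreal) \<Rightarrow> bool" where
  "null_in_probability M Z \<longleftrightarrow>
     (\<forall>\<epsilon>>0. (\<lambda>j. measure M {w\<in>space M. \<epsilon> < Z j w}) \<longlonglongrightarrow> 0)"

(* The random variable I is (a version of) the integral of H over [0,t] with respect to W:
   the limit in probability of integrals of simple processes H^j such that the integral of
   (H^j - H)^2 over [0,t] tends to 0 in probability. *)
definition has_ito_integral ::
  "'w measure \<Rightarrow> (real \<Rightarrow> 'w measure) \<Rightarrow> (real \<Rightarrow> 'w \<Rightarrow> real) \<Rightarrow> (real \<Rightarrow> 'w \<Rightarrow> real) \<Rightarrow> real
     \<Rightarrow> ('w \<Rightarrow> real) \<Rightarrow> bool" where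
  "has_ito_integral M Fl W H t I \<longleftrightarrow>
     (\<forall>s\<in>{0..t}. (\<lambda>(r, w). H r w) \<in> borel_measurable (restrict_space borel {0..s} \<Otimes>\<^sub>M Fl s)) \<and>
     I \<in> borel_measurable M \<and>
     (\<exists>n \<tau> \<xi>.
        (\<forall>j. simple_process Fl (n j) (\<tau> j) (\<xi> j)) \<and>
        null_in_probability M
          (\<lambda>j w. \<integral>\<^sup>+s\<in>{0..t}. ennreal ((simple_value (n j) (\<tau> j) (\<xi> j) s w - H s w)\<^sup>2) \<partial>lborel) \<and>
        null_in_probability M
          (\<lambda>j w. ennreal \<bar>simple_integral W (n j) (\<tau> j) (\<xi> j) t w - I w\<bar>))"

(* X solves dX = k (theta - X) dt + delta sqrt (X (1 - X)) dW on [0,T] with X_0 = x. *)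
definition jacobi_process ::
  "real \<Rightarrow> real \<Rightarrow> real \<Rightarrow> real \<Rightarrow> 'w measure \<Rightarrow> (real \<Rightarrow> 'w measure) \<Rightarrow> (real \<Rightarrow> 'w \<Rightarrow> real)
     \<Rightarrow> real \<Rightarrow> (real \<Rightarrow> 'w \<Rightarrow> real) \<Rightarrow> bool" where
  "jacobi_process T k \<theta> \<delta> M Fl W x X \<longleftrightarrow>
     (\<forall>t\<in>{0..T}. X t \<in> borel_measurable (Fl t)) \<and>
     (\<forall>w\<in>space M. X 0 w = x \<and> continuous_on {0..T} (\<lambda>t. X t w) \<and> (\<forall>t\<in>{0..T}. X t w \<in> {0..1})) \<and>
     (\<forall>t\<in>{0..T}. \<exists>I.
        has_ito_integral M Fl W (\<lambda>s w. \<delta> * sqrt (X s w * (1 - X s w))) t I \<and>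
        (AE w in M. X t w = x + (LBINT s:{0..t}. k * (\<theta> - X s w)) + I w))"

definition output_distribution ::
  "real \<Rightarrow> 'w measure \<Rightarrow> (real \<Rightarrow> real \<Rightarrow> 'w \<Rightarrow> real) \<Rightarrow> real measure \<Rightarrow> (real \<Rightarrow> real measure) \<Rightarrow> bool"
where
  "output_distribution T M S \<eta>0 \<eta>bar \<longleftrightarrow>
     (\<forall>t\<in>{0..T}.
        sets (\<eta>bar t) = sets (restrict_space borel {0..1}) \<and>
        (\<forall>A\<in>sets (restrict_space borel {0..1}).
           emeasure (\<eta>bar t) A = (\<integral>\<^sup>+x. emeasure M {w\<in>space M. S x t w \<in> A} \<partial>\<eta>0)))"


section \<open>Generators and flows of measures\<close>

(* A generator is given as a function of x, f'(x) and f''(x). *)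
definition cir_generator :: "real \<Rightarrow> real \<Rightarrow> real \<Rightarrow> real \<Rightarrow> real \<Rightarrow> real \<Rightarrow> real" where
  "cir_generator k \<theta> \<delta> x p q = k * (\<theta> - x) * p + \<delta>\<^sup>2 * x / 2 * q"

definition jacobi_generator :: "real \<Rightarrow> real \<Rightarrow> real \<Rightarrow> real \<Rightarrow> real \<Rightarrow> real \<Rightarrow> real" where
  "jacobi_generator k \<theta> \<delta> x p q = k * (\<theta> - x) * p + \<delta>\<^sup>2 * x * (1 - x) / 2 * q"

(* u is of class C^{1,2} on [0,T] x X, with u_t = ut, u_x = ux, u_xx = uxx
   (one-sided derivatives at boundary points). *)
definition C12 ::
  "real \<Rightarrow> real set \<Rightarrow> (real \<Rightarrow> real \<Rightarrow> real) \<Rightarrow> (real \<Rightarrow> real \<Rightarrow> real) \<Rightarrow> (real \<Rightarrow> real \<Rightarrow> real)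
     \<Rightarrow> (real \<Rightarrow> real \<Rightarrow> real) \<Rightarrow> bool" where
  "C12 T X u ut ux uxx \<longleftrightarrow>
     (\<forall>f\<in>{u, ut, ux, uxx}. continuous_on ({0..T} \<times> X) (\<lambda>(t, x). f t x)) \<and>
     (\<forall>t\<in>{0..T}. \<forall>x\<in>X.
        ((\<lambda>s. u s x) has_real_derivative ut t x) (at t within {0..T}) \<and>
        ((\<lambda>y. u t y) has_real_derivative ux t x) (at x within X) \<and>
        ((\<lambda>y. ux t y) has_real_derivative uxx t x) (at x within X))"

(* The flows of positive bounded measures in the space V_X, given by representatives of the
   classes of almost everywhere equal flows; the values m t for t outside [0,T] are irrelevant. *)
definition positive_flow :: "real \<Rightarrow> real set \<Rightarrow> (real \<Rightarrow> real measure) \<Rightarrow> bool" where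
  "positive_flow T X m \<longleftrightarrow>
     (\<forall>t\<in>{0..T}. finite_measure (m t) \<and> sets (m t) = sets (restrict_space borel X)) \<and>
     (\<forall>A\<in>sets (restrict_space borel X).
        (\<lambda>t. emeasure (m t) A) \<in> borel_measurable (lebesgue_on {0..T})) \<and>
     (\<integral>\<^sup>+t. emeasure (m t) X \<partial>lebesgue_on {0..T}) < \<infinity>"

(* The integral of the possibly unbounded u(0,.) >= 0 may be infinite, in which case the
   inequality holds. *)
definition admissible_flows ::
  "real \<Rightarrow> real set \<Rightarrow> (real \<Rightarrow> real \<Rightarrow> real \<Rightarrow> real) \<Rightarrow> real measure \<Rightarrow> (real \<Rightarrow> real measure) set"
where
  "admissible_flows T X L m0 =
     {m. positive_flow T X m \<and>
        (\<forall>u ut ux uxx.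
           C12 T X u ut ux uxx \<and> (\<forall>t\<in>{0..T}. \<forall>x\<in>X. 0 \<le> u t x) \<and>
           bounded ((\<lambda>(t, x). ut t x + L x (ux t x) (uxx t x)) ` ({0..T} \<times> X)) \<longrightarrow>
           0 \<le> enn2ereal (\<integral>\<^sup>+x. ennreal (u 0 x) \<partial>m0) +
               ereal (LINT t|lebesgue_on {0..T}. LINT x|m t. ut t x + L x (ux t x) (uxx t x)))}"


section \<open>Supply, gain, price, equilibrium\<close>

definition smooth_on_open :: "real set \<Rightarrow> (real \<Rightarrow> real) \<Rightarrow> bool" where
  "smooth_on_open U f \<longleftrightarrow> open U \<and> (\<forall>n. \<forall>x\<in>U. (deriv ^^ n) f differentiable (at x))"

definition supply_curve :: "(real \<Rightarrow> real) \<Rightarrow> real \<Rightarrow> real" where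
  "supply_curve c y = (if y \<le> 0 then 0 else if y \<ge> c 1 then 1 else the_inv_into {0..1} c y)"

definition gain :: "(real \<Rightarrow> real) \<Rightarrow> real \<Rightarrow> real" where
  "gain F x = (LBINT z=0..x. F z)"

definition f_C :: "real \<Rightarrow> real \<Rightarrow> real \<Rightarrow> real \<Rightarrow> real \<Rightarrow> real" where
  "f_C \<rho> \<kappa> K \<gamma> t = - \<kappa> - exp (- \<gamma> * t) * K * (\<rho> + \<gamma>)"

definition f_R :: "real \<Rightarrow> real \<Rightarrow> real \<Rightarrow> real \<Rightarrow> real \<Rightarrow> real \<Rightarrow> real" where
  "f_R T \<rho> \<kappa> K \<gamma> t = \<kappa> + \<rho> * K + \<gamma> * K * exp (- (\<rho> + \<gamma>) * (T - t))"

definition renewable_output :: "real measure \<Rightarrow> real measure \<Rightarrow> real" where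
  "renewable_output \<eta>bar \<eta> = (LINT x|\<eta>bar. x) - (LINT x|\<eta>. x)"

(* The infimum is taken in the extended reals, where the infimum of the empty set is oo. *)
definition price ::
  "real \<Rightarrow> (real \<Rightarrow> real) \<Rightarrow> (real \<Rightarrow> real measure) \<Rightarrow> (real \<Rightarrow> real) \<Rightarrow> (real \<Rightarrow> real)
     \<Rightarrow> real \<Rightarrow> real measure \<Rightarrow> real measure \<Rightarrow> real" where
  "price Pbar D \<eta>bar F F0 t \<omega> \<eta> =
     real_of_ereal
       (min (Inf (ereal ` {P. 0 \<le> P \<and>
                max (D t - renewable_output (\<eta>bar t) \<eta>) 0 \<le> (LINT x|\<omega>. F (P - x)) + F0 P}))
            (ereal Pbar))"

definition nash_equilibrium ::
  "real \<Rightarrow> real \<Rightarrow> (real \<Rightarrow> real measure) set \<Rightarrow> (real \<Rightarrow> real measure) set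
     \<Rightarrow> (real \<Rightarrow> real) \<Rightarrow> (real \<Rightarrow> real) \<Rightarrow> (real \<Rightarrow> real)
     \<Rightarrow> (real \<Rightarrow> real measure \<Rightarrow> real measure \<Rightarrow> real)
     \<Rightarrow> (real \<Rightarrow> real measure) \<Rightarrow> (real \<Rightarrow> real measure) \<Rightarrow> bool" where
  "nash_equilibrium T \<rho> \<A> \<A>bar G fC fR P \<omega>' \<eta>' \<longleftrightarrow>
     \<omega>' \<in> \<A> \<and> \<eta>' \<in> \<A>bar \<and>
     (\<forall>\<omega>\<in>\<A>.
        (LINT t|lebesgue_on {0..T}. LINT x|\<omega> t. exp (- \<rho> * t) * (G (P t (\<omega>' t) (\<eta>' t) - x) + fC t))
        \<le> (LINT t|lebesgue_on {0..T}. LINT x|\<omega>' t. exp (- \<rho> * t) * (G (P t (\<omega>' t) (\<eta>' t) - x) + fC t))) \<and>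
     (\<forall>\<eta>\<in>\<A>bar.
        (LINT t|lebesgue_on {0..T}. LINT x|\<eta> t. exp (- \<rho> * t) * (- P t (\<omega>' t) (\<eta>' t) * x + fR t))
        \<le> (LINT t|lebesgue_on {0..T}. LINT x|\<eta>' t. exp (- \<rho> * t) * (- P t (\<omega>' t) (\<eta>' t) * x + fR t)))"

end

theory Submission
  imports Defs
begin

text \<open>Adding the four optimality inequalities that compare the two equilibria with each other
  shows that the integral over \<open>t\<close> of \<open>e\<^sup>-\<^sup>\<rho>\<^sup>t H t\<close> is nonnegative, where
  \<open>H t = \<integral>(G(P1 - x) - G(P2 - x)) (\<omega>1 - \<omega>2)(dx) - (P1 - P2) \<integral>x (\<eta>1 - \<eta>2)(dx)\<close>.
  If \<open>P2 < P1\<close> at time \<open>t\<close>, then for every \<open>p\<close> strictly between them demand exceeds supply in the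
  first market but not in the second, so that \<open>\<integral>F(p - x) (\<omega>1 - \<omega>2)(dx) < \<integral>x (\<eta>1 - \<eta>2)(dx)\<close>.
  Integrating over \<open>p\<close> gives \<open>H t < 0\<close>. Hence \<open>H = 0\<close> almost everywhere, and the prices agree there.
  The inequalities between Bochner integrals can be added only because the prices are measurable
  in \<open>t\<close>, which in turn needs the measurability of the mean of \<open>\<eta>bar t\<close>.\<close>

section \<open>Mean output of the potential renewable projects\<close>

text \<open>For any \<open>f\<close>, measurable or not, \<open>nn_integral\<close> is a supremum
  over the simple functions below \<open>f\<close>. A sequence of them already reaches this
  supremum, and its pointwise supremum is measurable and still below \<open>f\<close>.\<close>

lemma nn_integral_minorant:
  fixes f :: "'a \<Rightarrow> ennreal"
  obtains g where "g \<in> borel_measurable M" "g \<le> f" "integral\<^sup>N M g = integral\<^sup>N M f"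
proof -
  let ?A = "{g. simple_function M g \<and> g \<le> f}"
  have "?A \<noteq> {}" by (auto intro!: exI[of _ "\<lambda>_. 0"] simp: le_fun_def)
  from ennreal_SUP_countable_SUP[OF this, of "integral\<^sup>S M"]
  obtain I :: "nat \<Rightarrow> ennreal" where I: "range I \<subseteq> integral\<^sup>S M ` ?A"
    "integral\<^sup>N M f = (SUP n. I n)" by (auto simp: nn_integral_def)
  have "\<forall>n. \<exists>s. simple_function M s \<and> s \<le> f \<and> I n = integral\<^sup>S M s"
    using I(1) by (fastforce simp: image_subset_iff)
  then obtain s where s: "\<And>n. simple_function M (s n)" "\<And>n. s n \<le> f"
    "\<And>n. I n = integral\<^sup>S M (s n)" by metis
  let ?g = "\<lambda>x. SUP n. s n x"
  have le: "?g \<le> f" using s(2) by (auto simp: le_fun_def intro!: SUP_least)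
  have "(SUP n. I n) \<le> integral\<^sup>N M ?g"
    unfolding s(3) nn_integral_eq_simple_integral[OF s(1), symmetric]
    by (intro SUP_least nn_integral_mono SUP_upper) auto
  moreover have "integral\<^sup>N M ?g \<le> integral\<^sup>N M f"
    using le by (intro nn_integral_mono) (auto simp: le_fun_def)
  ultimately show thesis using I(2) le s(1)
    by (intro that[of ?g] borel_measurable_SUP) (auto intro: borel_measurable_simple_function)
qed

text \<open>For a function that is not measurable, \<^const>\<open>nn_integral\<close> is the lower integral, so the
  hypothesis says that the lower and the upper integral of \<open>f\<close> agree.\<close>
lemma measurable_completion_if_complementary_nn_integrals:
  fixes f :: "'a \<Rightarrow> ennreal"
  assumes "finite_measure M" and f1: "\<And>x. x \<in> space M \<Longrightarrow> f x \<le> 1"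
    and sum: "integral\<^sup>N M f + (\<integral>\<^sup>+x. 1 - f x \<partial>M) = emeasure M (space M)"
  shows "f \<in> borel_measurable (completion M)"
proof -
  interpret finite_measure M by fact
  \<comment> \<open>On the space, \<open>f\<close> is squeezed between the measurable functions
    \<open>g\<close> and \<open>1 - h\<close>. The hypothesis on the integrals says that
    \<open>g + h\<close> has the integral of \<open>1\<close>, so the two bounds agree almost
    everywhere.\<close>
  obtain g where g[measurable]: "g \<in> borel_measurable M" and "g \<le> f"
    and gi: "integral\<^sup>N M g = integral\<^sup>N M f" by (rule nn_integral_minorant)
  obtain h where h[measurable]: "h \<in> borel_measurable M" and "h \<le> (\<lambda>x. 1 - f x)"
    and hi: "integral\<^sup>N M h = (\<integral>\<^sup>+x. 1 - f x \<partial>M)" by (rule nn_integral_minorant)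
  have gf: "g x \<le> f x" and hf: "h x \<le> 1 - f x" for x
    using \<open>g \<le> f\<close> \<open>h \<le> _\<close> by (auto simp: le_fun_def)
  have gh1: "g x + h x \<le> 1" if "x \<in> space M" for x
    using add_mono[OF gf hf, of x x] f1[OF that] by (simp add: add_diff_inverse_ennreal)
  have "(\<integral>\<^sup>+x. g x + h x \<partial>M) = (\<integral>\<^sup>+x. 1 \<partial>M)"
    using sum by (simp add: nn_integral_add gi hi)
  then have "(\<integral>\<^sup>+x. 1 - (g x + h x) \<partial>M) = 0"
    by (subst nn_integral_diff) (auto simp: gh1 emeasure_finite)
  then have "AE x in M. 1 - (g x + h x) = 0"
    by (subst (asm) nn_integral_0_iff_AE) auto
  then have "AE x in M. g x = f x"
    using AE_space
  proof eventually_elim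
    case (elim x)
    then have gh: "g x + h x = 1"
      using gh1[OF elim(2)] by (metis diff_eq_0_iff_ennreal add_diff_inverse_ennreal add.right_neutral)
    \<comment> \<open>Cancelling \<open>h x\<close> on both sides of an inequality in
      \<open>ennreal\<close> requires it to be finite.\<close>
    have "h x \<noteq> top" using hf[of x] by (metis diff_le_self_ennreal ennreal_one_neq_top order_trans top.extremum_uniqueI)
    have "f x + h x \<le> f x + (1 - f x)" using hf[of x] by (intro add_left_mono)
    also have "\<dots> = g x + h x" using gh f1[OF elim(2)] by (simp add: add_diff_inverse_ennreal)
    finally have "f x \<le> g x" using \<open>h x \<noteq> top\<close> by (simp add: add.commute)
    with gf[of x] show ?case by simp
  qed
  then have ae: "AE x in completion M. g x = f x"
    by (rule AE_completion)
  show ?thesis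
  proof (rule measurableI)
    fix A :: "ennreal set" assume A: "A \<in> sets borel"
    show "f -` A \<inter> space (completion M) \<in> sets (completion M)"
    \<comment> \<open>In a complete measure, a set that differs from a measurable one only on a null
      set is measurable.\<close>
    proof (rule completion.in_sets_AE)
      show "g -` A \<inter> space (completion M) \<in> sets (completion M)"
        using measurable_completion[OF g] A by (rule measurable_sets)
      show "AE x in completion M. x \<in> g -` A \<inter> space (completion M) \<longleftrightarrow> x \<in> f -` A \<inter> space (completion M)"
        using ae by eventually_elim auto
    qed auto
  qed simp
qed

text \<open>The law of \<open>S x t\<close> is not assumed to depend measurably on \<open>x\<close>. It does so up to
  completion of \<open>\<eta>0\<close>, because the total mass of \<open>\<eta>bar t\<close> is additive over complementary
  sets; continuity in \<open>t\<close> is then dominated convergence along the continuous paths.\<close>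
lemma output_mean_continuous:
  assumes fin: "finite_measure \<eta>0" and sets0: "sets \<eta>0 = sets (restrict_space borel {0..1})"
    and "prob_space M"
    and S: "\<And>x t. x \<in> {0..1} \<Longrightarrow> t \<in> {0..T} \<Longrightarrow> S x t \<in> M \<rightarrow>\<^sub>M restrict_space borel {0..1}"
    and cont: "\<And>x w. x \<in> {0..1} \<Longrightarrow> w \<in> space M \<Longrightarrow> continuous_on {0..T} (\<lambda>t. S x t w)"
    and out: "output_distribution T M S \<eta>0 \<eta>bar"
  shows "continuous_on {0..T} (\<lambda>t. LINT x|\<eta>bar t. x)"
proof -
  interpret M: prob_space M by fact
  interpret finite_measure \<eta>0 by fact
  interpret N: finite_measure "completion \<eta>0"
    by (rule finite_measureI) (simp add: emeasure_finite)
  let ?B = "restrict_space borel {0..1::real}" and ?N = "completion \<eta>0"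
  define K where "K t x = distr M ?B (S x t)" for t x
  have sp: "space \<eta>0 = {0..1}" using sets_eq_imp_space_eq[OF sets0] by simp
  have id: "(\<lambda>x. x) \<in> borel_measurable ?B" by (rule measurable_restrict_space1) simp
  have KA: "emeasure (K t x) A = emeasure M {w \<in> space M. S x t w \<in> A}"
    if "t \<in> {0..T}" "x \<in> {0..1}" "A \<in> sets ?B" for t x A
    unfolding K_def using S[OF that(2,1)] that(3)
    by (subst emeasure_distr) (auto intro!: arg_cong[where f="emeasure M"])
  have bar: "emeasure (\<eta>bar t) A = (\<integral>\<^sup>+x. emeasure (K t x) A \<partial>\<eta>0)"
    if "t \<in> {0..T}" "A \<in> sets ?B" for t A
  proof -
    have "emeasure (\<eta>bar t) A = (\<integral>\<^sup>+x. emeasure M {w \<in> space M. S x t w \<in> A} \<partial>\<eta>0)"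
      using out that unfolding output_distribution_def by auto
    also have "\<dots> = (\<integral>\<^sup>+x. emeasure (K t x) A \<partial>\<eta>0)"
      using that by (intro nn_integral_cong) (simp add: KA sp)
    finally show ?thesis .
  qed
  have Kprob: "prob_space (K t x)" if "t \<in> {0..T}" "x \<in> {0..1}" for t x
    unfolding K_def using S[OF that(2,1)] by (rule M.prob_space_distr)
  have Kmeas: "(\<lambda>x. emeasure (K t x) A) \<in> borel_measurable ?N"
    if t: "t \<in> {0..T}" and A: "A \<in> sets ?B" for t A
  proof (rule measurable_completion_if_complementary_nn_integrals)
    have Asub: "A \<subseteq> {0..1}" using sets.sets_into_space[OF A] by simp
    have A': "{0..1} - A \<in> sets ?B" using sets.compl_sets[OF A] by simp
    have I: "{0..1} \<in> sets ?B" using sets.top[of ?B] by simp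
    have sb: "sets (\<eta>bar t) = sets ?B" using out t unfolding output_distribution_def by auto
    have compl: "1 - emeasure (K t x) A = emeasure (K t x) ({0..1} - A)" if "x \<in> {0..1}" for x
    proof -
      interpret K: prob_space "K t x" using t that by (rule Kprob)
      have "sets (K t x) = sets ?B" by (simp add: K_def)
      then show ?thesis using K.emeasure_space_1 A emeasure_compl[of A "K t x"]
        by (simp add: sets_eq_imp_space_eq[OF \<open>sets (K t x) = sets ?B\<close>])
    qed
    have "(\<integral>\<^sup>+x. emeasure (K t x) A \<partial>\<eta>0) + (\<integral>\<^sup>+x. 1 - emeasure (K t x) A \<partial>\<eta>0)
      = emeasure (\<eta>bar t) A + emeasure (\<eta>bar t) ({0..1} - A)"
      unfolding bar[OF t A] bar[OF t A']
      by (intro arg_cong2[where f="(+)"] nn_integral_cong refl compl) (simp add: sp)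
    also have "\<dots> = emeasure (\<eta>bar t) {0..1}"
      using plus_emeasure[of A "\<eta>bar t" "{0..1} - A"] A A' Asub by (simp add: sb Un_absorb1)
    also have "\<dots> = (\<integral>\<^sup>+x. emeasure (K t x) {0..1} \<partial>\<eta>0)" by (rule bar[OF t I])
    also have "\<dots> = (\<integral>\<^sup>+x. 1 \<partial>\<eta>0)"
      using prob_space.emeasure_space_1[OF Kprob[OF t]]
      by (intro nn_integral_cong) (simp add: sp K_def)
    finally show "(\<integral>\<^sup>+x. emeasure (K t x) A \<partial>\<eta>0) + (\<integral>\<^sup>+x. 1 - emeasure (K t x) A \<partial>\<eta>0)
      = emeasure \<eta>0 (space \<eta>0)" by simp
    show "emeasure (K t x) A \<le> 1" if "x \<in> space \<eta>0" for x
      using prob_space.emeasure_le_1[OF Kprob[OF t]] that by (simp add: sp)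
  qed fact
  have Ksub: "K t \<in> ?N \<rightarrow>\<^sub>M subprob_algebra ?B" if t: "t \<in> {0..T}" for t
    using Kmeas[OF t] Kprob[OF t]
    by (intro measurable_subprob_algebra) (auto simp: sp K_def intro!: prob_space_imp_subprob_space)
  \<comment> \<open>The laws now form a measurable kernel over the completed measure, and completion
    does not change \<open>nn_integral\<close>. So \<open>\<eta>bar t\<close> is the mixture of the
    kernel, and integrals over it can be disintegrated.\<close>
  have barK: "\<eta>bar t = ?N \<bind> K t" if t: "t \<in> {0..T}" for t
  proof (rule measure_eqI)
    have sb: "sets (\<eta>bar t) = sets ?B" using out t unfolding output_distribution_def by auto
    then show "sets (\<eta>bar t) = sets (?N \<bind> K t)"
      by (subst sets_bind[where N="?B"]) (auto simp: sp K_def)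
    fix A assume "A \<in> sets (\<eta>bar t)"
    then show "emeasure (\<eta>bar t) A = emeasure (?N \<bind> K t) A"
      using bar[OF t] sb by (subst emeasure_bind[OF _ Ksub[OF t]]) (auto simp: sp nn_integral_completion)
  qed
  define E where "E t x = (LINT w|M. S x t w)" for t x
  have Sm: "S x t \<in> borel_measurable M" if "t \<in> {0..T}" "x \<in> {0..1}" for t x
    using measurable_compose[OF S[OF that(2,1)] id] by simp
  have S01: "S x t w \<in> {0..1}" if "t \<in> {0..T}" "x \<in> {0..1}" "w \<in> space M" for t x w
    using measurable_space[OF S[OF that(2,1)] that(3)] by simp
  have Si: "integrable M (S x t)" if "t \<in> {0..T}" "x \<in> {0..1}" for t x
    using Sm[OF that] S01[OF that] by (intro M.integrable_const_bound[where B=1]) auto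
  \<comment> \<open>Reading the mean of \<open>S x t\<close> as an integral against the kernel makes
    it measurable in the starting point \<open>x\<close>.\<close>
  have Enn: "(\<integral>\<^sup>+y. ennreal y \<partial>K t x) = ennreal (E t x)" if "t \<in> {0..T}" "x \<in> {0..1}" for t x
  proof -
    have "(\<integral>\<^sup>+y. ennreal y \<partial>K t x) = (\<integral>\<^sup>+w. ennreal (S x t w) \<partial>M)"
      unfolding K_def using id by (intro nn_integral_distr S that) measurable
    also have "\<dots> = ennreal (E t x)"
      unfolding E_def using S01[OF that] by (intro nn_integral_eq_integral Si that) auto
    finally show ?thesis .
  qed
  have E01: "0 \<le> E t x" "E t x \<le> 1" if "t \<in> {0..T}" "x \<in> {0..1}" for t x
    unfolding E_def using S01[OF that]
    by (auto intro!: Bochner_Integration.integral_nonneg M.integral_le_const Si that)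
  have Em: "E t \<in> borel_measurable ?N" if t: "t \<in> {0..T}" for t
  proof -
    have "(\<lambda>x. enn2real (\<integral>\<^sup>+y. ennreal y \<partial>K t x)) \<in> borel_measurable ?N"
      using nn_integral_measurable_subprob_algebra[of "\<lambda>y. ennreal y" ?B] id Ksub[OF t]
      by measurable
    then show ?thesis
      by (rule measurable_cong[THEN iffD1, rotated]) (simp add: Enn[OF t] E01[OF t] sp)
  qed
  have mean: "(LINT x|\<eta>bar t. x) = (LINT x|?N. E t x)" if t: "t \<in> {0..T}" for t
  proof -
    have sb: "sets (\<eta>bar t) = sets ?B" using out t unfolding output_distribution_def by auto
    have spb: "space (\<eta>bar t) = {0..1}" using sets_eq_imp_space_eq[OF sb] by simp
    have "(LINT x|\<eta>bar t. x) = enn2real (\<integral>\<^sup>+x. ennreal x \<partial>\<eta>bar t)"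
      using id measurable_cong_sets[OF sb refl, of borel] by (intro integral_eq_nn_integral) (auto simp: spb)
    also have "(\<integral>\<^sup>+x. ennreal x \<partial>\<eta>bar t) = (\<integral>\<^sup>+x. \<integral>\<^sup>+y. ennreal y \<partial>K t x \<partial>?N)"
      unfolding barK[OF t] using id by (intro nn_integral_bind[OF _ Ksub[OF t]]) measurable
    also have "\<dots> = (\<integral>\<^sup>+x. ennreal (E t x) \<partial>?N)"
      by (intro nn_integral_cong Enn t) (simp add: sp)
    finally show ?thesis
      using Em[OF t] E01[OF t] by (subst integral_eq_nn_integral) (auto simp: sp)
  qed
  have "continuous_on {0..T} (\<lambda>t. LINT x|?N. E t x)"
  proof (unfold continuous_on_sequentially, intro ballI allI impI)
    \<comment> \<open>Dominated convergence is applied twice: over \<open>M\<close> for a fixed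
      start \<open>x\<close>, along continuous paths with values in \<open>[0,1]\<close>, and then
      over the starts.\<close>
    fix u t assume t: "t \<in> {0..T}" and u: "(\<forall>n. u n \<in> {0..T}) \<and> u \<longlonglongrightarrow> t"
    have "(\<lambda>n. E (u n) x) \<longlonglongrightarrow> E t x" if x: "x \<in> {0..1}" for x
      unfolding E_def
    proof (rule integral_dominated_convergence[where w="\<lambda>_. 1"])
      show "AE w in M. (\<lambda>n. S x (u n) w) \<longlonglongrightarrow> S x t w"
        using cont[OF x] t u unfolding continuous_on_sequentially by (intro AE_I2) (auto simp: o_def)
      show "AE w in M. norm (S x (u n) w) \<le> 1" for n
        using S01[OF _ x] u by (intro AE_I2) auto
    qed (use Sm x t u in auto)
    then show "((\<lambda>t. LINT x|?N. E t x) \<circ> u) \<longlonglongrightarrow> (LINT x|?N. E t x)"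
      unfolding o_def
    proof (intro integral_dominated_convergence[where w="\<lambda>_. 1"])
      assume "\<And>x. x \<in> {0..1} \<Longrightarrow> (\<lambda>n. E (u n) x) \<longlonglongrightarrow> E t x"
      then show "AE x in ?N. (\<lambda>n. E (u n) x) \<longlonglongrightarrow> E t x"
        by (intro AE_I2) (simp add: sp)
      show "AE x in ?N. norm (E (u n) x) \<le> 1" for n
        using E01 u by (intro AE_I2) (auto simp: sp)
    qed (use Em t u in auto)
  qed
  then show ?thesis
    by (rule continuous_on_cong[THEN iffD1, rotated 2]) (simp_all add: mean)
qed

section \<open>Integration along flows of measures\<close>

lemma positive_flowD:
  assumes "positive_flow T X m" "t \<in> {0..T}"
  shows "finite_measure (m t)" "sets (m t) = sets (restrict_space borel X)" "space (m t) = X"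
proof -
  show "finite_measure (m t)" and *: "sets (m t) = sets (restrict_space borel X)"
    using assms unfolding positive_flow_def by blast+
  show "space (m t) = X" using sets_eq_imp_space_eq[OF *] by (simp add: space_restrict_space)
qed

lemma positive_flow_integrable:
  fixes g :: "real \<Rightarrow> real"
  assumes "positive_flow T X m" "t \<in> {0..T}"
    and "g \<in> borel_measurable (restrict_space borel X)" "\<And>x. x \<in> X \<Longrightarrow> \<bar>g x\<bar> \<le> B"
  shows "integrable (m t) g"
proof -
  note m = positive_flowD[OF assms(1,2)]
  interpret finite_measure "m t" by (rule m)
  show ?thesis
  proof (rule integrable_const_bound)
    show "AE x in m t. norm (g x) \<le> B" using assms(4) by (intro AE_I2) (simp add: m(3))
    show "g \<in> borel_measurable (m t)" using assms(3) by (simp only: measurable_cong_sets[OF m(2) refl])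
  qed
qed

text \<open>Dividing \<open>m t\<close> by \<open>1 +\<close> its mass gives a sub-probability kernel.\<close>
lemma positive_flow_integral_measurable:
  fixes f :: "real \<Rightarrow> real \<Rightarrow> real"
  assumes m: "positive_flow T X m"
    and f: "case_prod f \<in> borel_measurable (lebesgue_on {0..T} \<Otimes>\<^sub>M restrict_space borel X)"
    and bound: "\<And>t x. t \<in> {0..T} \<Longrightarrow> x \<in> X \<Longrightarrow> \<bar>f t x\<bar> \<le> B"
    and X0: "X \<noteq> {}"
  shows "(\<lambda>t. LINT x|m t. f t x) \<in> borel_measurable (lebesgue_on {0..T})"
proof -
  let ?L = "lebesgue_on {0..T}" and ?B = "restrict_space borel X"
  note mD = positive_flowD[OF m]
  have X: "X \<in> sets ?B" using sets.top[of ?B, unfolded space_restrict_space] by simp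
  have mA[measurable]: "(\<lambda>t. emeasure (m t) A) \<in> borel_measurable ?L" if "A \<in> sets ?B" for A
    using m that by (simp add: positive_flow_def)
  \<comment> \<open>Adding 1 keeps the divisor positive even where \<open>m t\<close> is the zero
    measure, so the normalisation can be undone by multiplying with \<open>r t\<close>.\<close>
  define r where "r t = 1 + emeasure (m t) X" for t
  have [measurable]: "r \<in> borel_measurable ?L"
    unfolding r_def using mA[OF X] by measurable
  have r: "0 < r t" "r t < top" if "t \<in> {0..T}" for t
    using finite_measure.emeasure_finite[OF mD(1)[OF that], of X]
    by (auto simp: r_def less_top[symmetric] add_pos_nonneg)
  have r1: "r t * inverse (r t) = 1" if "t \<in> {0..T}" for t
    using ennreal_divide_self[of "r t"] r[OF that] by (simp add: divide_ennreal_def)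
  define n where "n t = scale_measure (inverse (r t)) (m t)" for t
  have n: "n \<in> ?L \<rightarrow>\<^sub>M subprob_algebra ?B"
  proof (rule measurable_subprob_algebra)
    fix t assume "t \<in> space ?L" then have t: "t \<in> {0..T}" by simp
    have sp: "space (n t) = X" using mD(3)[OF t] by (simp add: n_def space_scale_measure)
    show "sets (n t) = sets ?B" using mD(2)[OF t] by (simp add: n_def)
    show "subprob_space (n t)"
    proof
      have "emeasure (n t) (space (n t)) = inverse (r t) * emeasure (m t) X"
        by (simp only: sp) (simp add: n_def)
      also have "\<dots> \<le> inverse (r t) * r t"
        by (intro mult_left_mono) (auto simp: r_def)
      also have "\<dots> = 1"
        using r1[OF t] by (simp add: mult.commute)
      finally show "emeasure (n t) (space (n t)) \<le> 1" .
      show "space (n t) \<noteq> {}" using X0 by (simp add: sp)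
    qed
  next
    fix A assume "A \<in> sets ?B"
    then show "(\<lambda>t. emeasure (n t) A) \<in> borel_measurable ?L"
      unfolding n_def emeasure_scale_measure using mA by measurable
  qed
  have nn: "(\<lambda>t. \<integral>\<^sup>+x. ennreal (h t x) \<partial>m t) \<in> borel_measurable ?L"
    if h: "case_prod h \<in> borel_measurable (?L \<Otimes>\<^sub>M ?B)" for h :: "real \<Rightarrow> real \<Rightarrow> real"
  proof -
    have "(\<lambda>t. \<integral>\<^sup>+x. ennreal (h t x) \<partial>n t) \<in> borel_measurable ?L"
      using h by (intro nn_integral_measurable_subprob_algebra2[OF _ n]) (simp add: case_prod_beta')
    then have "(\<lambda>t. r t * (\<integral>\<^sup>+x. ennreal (h t x) \<partial>n t)) \<in> borel_measurable ?L"
      by measurable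
    moreover have "r t * (\<integral>\<^sup>+x. ennreal (h t x) \<partial>n t) = (\<integral>\<^sup>+x. ennreal (h t x) \<partial>m t)"
      if "t \<in> space ?L" for t
    proof -
      have t: "t \<in> {0..T}" using that by simp
      have "h t \<in> borel_measurable ?B" using measurable_Pair2[OF h that] by simp
      then have "(\<lambda>x. ennreal (h t x)) \<in> borel_measurable (m t)"
        by (simp add: measurable_cong_sets[OF mD(2)[OF t] refl])
      then have "(\<integral>\<^sup>+x. ennreal (h t x) \<partial>n t) = inverse (r t) * (\<integral>\<^sup>+x. ennreal (h t x) \<partial>m t)"
        unfolding n_def by (rule nn_integral_scale_measure)
      then show ?thesis by (simp add: mult.assoc[symmetric] r1[OF t])
    qed
    ultimately show ?thesis by (rule measurable_cong[THEN iffD1, rotated])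
  qed
  have "(\<lambda>t. enn2real (\<integral>\<^sup>+x. ennreal (f t x) \<partial>m t) - enn2real (\<integral>\<^sup>+x. ennreal (- f t x) \<partial>m t))
      \<in> borel_measurable ?L"
    using nn[OF f] nn[of "\<lambda>t x. - f t x"] f by (auto simp: case_prod_beta')
  moreover have "(LINT x|m t. f t x) = enn2real (\<integral>\<^sup>+x. ennreal (f t x) \<partial>m t)
      - enn2real (\<integral>\<^sup>+x. ennreal (- f t x) \<partial>m t)" if "t \<in> space ?L" for t
  proof -
    have t: "t \<in> {0..T}" and "f t \<in> borel_measurable ?B"
      using measurable_Pair2[OF f that] that by simp_all
    then have "integrable (m t) (f t)"
      using bound[OF t] by (rule positive_flow_integrable[OF m])
    then show ?thesis by (rule real_lebesgue_integral_def)
  qed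
  ultimately show ?thesis by (rule measurable_cong[THEN iffD2, rotated])
qed

text \<open>The inner integral is at most \<open>B\<close> times the mass of \<open>m t\<close>, and
  that mass is integrable in time by the finiteness condition on flows. This is what allows
  integrals along different flows to be added and subtracted.\<close>

lemma positive_flow_integral_integrable:
  fixes f :: "real \<Rightarrow> real \<Rightarrow> real"
  assumes m: "positive_flow T X m"
    and f: "case_prod f \<in> borel_measurable (lebesgue_on {0..T} \<Otimes>\<^sub>M restrict_space borel X)"
    and bound: "\<And>t x. t \<in> {0..T} \<Longrightarrow> x \<in> X \<Longrightarrow> \<bar>f t x\<bar> \<le> B"
    and X0: "X \<noteq> {}"
  shows "integrable (lebesgue_on {0..T}) (\<lambda>t. LINT x|m t. f t x)"
proof -
  let ?L = "lebesgue_on {0..T}" and ?B = "restrict_space borel X"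
  note mD = positive_flowD[OF m]
  have X: "X \<in> sets ?B" using sets.top[of ?B, unfolded space_restrict_space] by simp
  have e: "emeasure (m t) X = ennreal (measure (m t) X)" if "t \<in> {0..T}" for t
    using finite_measure.emeasure_eq_measure[OF mD(1)[OF that]] .
  have em[measurable]: "(\<lambda>t. emeasure (m t) X) \<in> borel_measurable ?L"
    using m X by (simp add: positive_flow_def)
  have "(\<lambda>t. measure (m t) X) \<in> borel_measurable ?L"
    unfolding measure_def using em by measurable
  moreover have "(\<integral>\<^sup>+t. ennreal (measure (m t) X) \<partial>?L) < \<infinity>"
    using m unfolding positive_flow_def by (simp add: e cong: nn_integral_cong_simp)
  ultimately have "integrable ?L (\<lambda>t. measure (m t) X)"
    by (intro integrableI_nonneg) auto
  then have "integrable ?L (\<lambda>t. B * measure (m t) X)" by simp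
  then show ?thesis
  proof (rule Bochner_Integration.integrable_bound)
    show "(\<lambda>t. LINT x|m t. f t x) \<in> borel_measurable ?L"
      using m f bound X0 by (rule positive_flow_integral_measurable)
    show "AE t in ?L. norm (LINT x|m t. f t x) \<le> norm (B * measure (m t) X)"
    proof (rule AE_I2)
      fix t assume "t \<in> space ?L" then have t: "t \<in> {0..T}" by simp
      interpret finite_measure "m t" by (rule mD(1)[OF t])
      have i: "integrable (m t) (f t)"
      proof (rule positive_flow_integrable[OF m t])
        show "f t \<in> borel_measurable ?B" using measurable_Pair2[OF f, of t] t by simp
      qed (rule bound[OF t])
      have "norm (LINT x|m t. f t x) \<le> (LINT x|m t. \<bar>f t x\<bar>)"
        using integral_norm_bound[of "m t" "f t"] by simp
      also have "\<dots> \<le> (LINT x|m t. B)"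
        using i bound[OF t] by (intro integral_mono) (simp_all add: mD(3)[OF t])
      also have "\<dots> \<le> norm (B * measure (m t) X)" by (simp add: mD(3)[OF t] mult.commute)
      finally show "norm (LINT x|m t. f t x) \<le> norm (B * measure (m t) X)" .
    qed
  qed
qed

section \<open>Prices and gains\<close>

text \<open>The minimum lies between 0 and the cap, hence is finite, so \<open>real_of_ereal\<close>
  in the definition of \<open>price\<close> loses nothing.\<close>

lemma price_bounds:
  assumes "0 \<le> Pbar"
  shows "0 \<le> price Pbar D \<eta>bar F F0 t \<omega> \<eta>" "price Pbar D \<eta>bar F F0 t \<omega> \<eta> \<le> Pbar"
    and ereal_price: "ereal (price Pbar D \<eta>bar F F0 t \<omega> \<eta>) =
       min (Inf (ereal ` {P. 0 \<le> P \<and>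
                max (D t - renewable_output (\<eta>bar t) \<eta>) 0 \<le> (LINT x|\<omega>. F (P - x)) + F0 P})) (ereal Pbar)"
proof -
  let ?I = "Inf (ereal ` {P. 0 \<le> P \<and>
                max (D t - renewable_output (\<eta>bar t) \<eta>) 0 \<le> (LINT x|\<omega>. F (P - x)) + F0 P})"
  define v where "v = min ?I (ereal Pbar)"
  have "0 \<le> ?I" by (intro Inf_greatest) auto
  then have v: "0 \<le> v" "v \<le> ereal Pbar" using assms by (simp_all only: v_def min.cobounded2 min.bounded_iff ereal_less_eq)
  then have "\<bar>v\<bar> \<noteq> \<infinity>" by (cases v) auto
  then have e: "ereal (price Pbar D \<eta>bar F F0 t \<omega> \<eta>) = v"
    unfolding price_def v_def by (rule ereal_real')
  then show "ereal (price Pbar D \<eta>bar F F0 t \<omega> \<eta>) = min ?I (ereal Pbar)"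
    unfolding v_def .
  show "0 \<le> price Pbar D \<eta>bar F F0 t \<omega> \<eta>" "price Pbar D \<eta>bar F F0 t \<omega> \<eta> \<le> Pbar"
    using v unfolding e[symmetric] by auto
qed

text \<open>An infimum lies below \<open>a\<close> exactly when some member of the set does, whether
  or not it is attained. Both the measurability of the price and the comparison of two prices go
  through this criterion.\<close>

lemma price_less_iff:
  assumes "0 \<le> Pbar"
  shows "price Pbar D \<eta>bar F F0 t \<omega> \<eta> < a \<longleftrightarrow> Pbar < a \<or>
    (\<exists>P. 0 \<le> P \<and> P < a \<and> max (D t - renewable_output (\<eta>bar t) \<eta>) 0 \<le> (LINT x|\<omega>. F (P - x)) + F0 P)"
proof -
  have "price Pbar D \<eta>bar F F0 t \<omega> \<eta> < a \<longleftrightarrow> ereal (price Pbar D \<eta>bar F F0 t \<omega> \<eta>) < ereal a"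
    by simp
  then show ?thesis
    unfolding ereal_price[OF assms] min_less_iff_disj Inf_less_iff by auto
qed

lemma snd_borel_measurable: "snd \<in> borel_measurable (N \<Otimes>\<^sub>M restrict_space borel X)"
proof -
  have "(\<lambda>x. x) \<in> borel_measurable (restrict_space borel X)"
    by (rule measurable_restrict_space1) simp
  then show ?thesis by (rule measurable_compose[OF measurable_snd])
qed

lemma emeasure_restrict_lborel:
  fixes p q :: real
  assumes "p \<le> q"
  shows "emeasure (restrict_space lborel {p<..<q}) (space (restrict_space lborel {p<..<q})) = ennreal (q - p)"
  using assms by (subst emeasure_restrict_space) (auto simp: space_restrict_space)

text \<open>Isolates the analytic properties of the supply curve on which the gain and price
  arguments rest. \<open>bounded_supply_supply_curve\<close> derives them from the hypotheses on
  \<open>c\<close>.\<close>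

locale bounded_supply =
  fixes F :: "real \<Rightarrow> real"
  assumes F_mono: "mono F" and F_cont: "continuous_on UNIV F"
    and F_nonneg: "0 \<le> F y" and F_le_1: "F y \<le> 1" and F_neg: "y \<le> 0 \<Longrightarrow> F y = 0"
begin

section \<open>Calculus of the gain function\<close>

lemma F_meas [measurable]: "F \<in> borel_measurable borel"
  by (rule borel_measurable_continuous_onI[OF F_cont])

lemma F_abs: "\<bar>F y\<bar> \<le> 1"
  using F_nonneg F_le_1 by simp

lemma gain_DERIV: "(gain F has_real_derivative F y) (at y)"
proof -
  \<comment> \<open>This interval contains 0, the base point of the integral, and has
    \<open>y\<close> in its interior, so the one-sided form of the fundamental theorem gives a full
    derivative.\<close>
  let ?a = "- \<bar>y\<bar> - 1" and ?b = "\<bar>y\<bar> + 1"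
  have "((\<lambda>u. LBINT z=0..u. F z) has_vector_derivative F y) (at y within {?a..?b})"
    unfolding zero_ereal_def
    by (rule interval_integral_FTC2) (auto intro: continuous_on_subset[OF F_cont])
  moreover have "at y within {?a..?b} = at y"
    by (rule at_within_interior) auto
  ultimately show ?thesis
    unfolding has_real_derivative_iff_has_vector_derivative gain_def by simp
qed

lemma gain_cont: "continuous_on UNIV (gain F)"
  by (intro continuous_at_imp_continuous_on ballI DERIV_isCont[OF gain_DERIV])

lemma gain_meas [measurable]: "gain F \<in> borel_measurable borel"
  by (rule borel_measurable_continuous_onI[OF gain_cont])

lemma gain_mono: "x \<le> y \<Longrightarrow> gain F x \<le> gain F y"
  by (rule DERIV_nonneg_imp_nondecreasing) (auto intro!: exI conjI gain_DERIV F_nonneg)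

text \<open>Left of 0 the mean value theorem meets only zeros of \<open>F\<close>, so the gain
  vanishes there; right of 0 it increases from 0. With \<open>gain_mono\<close> this bounds
  \<open>gain F (p - x)\<close> for prices below the cap and \<open>x\<close> nonnegative.\<close>

lemma gain_nonneg: "0 \<le> gain F y"
proof (cases "y < 0")
  case True
  then obtain z where "y < z" "z < 0" "gain F 0 - gain F y = (0 - y) * F z"
    using MVT2[OF True, of "gain F" F] gain_DERIV by blast
  moreover have "gain F 0 = 0" by (simp add: gain_def zero_ereal_def)
  ultimately show ?thesis by (simp add: F_neg)
next
  case False
  then show ?thesis using gain_mono[of 0 y] by (simp add: gain_def zero_ereal_def)
qed

text \<open>The fundamental theorem of calculus, with the price interval turned into a finite
  measure of its own so that Fubini can be applied next.\<close>

lemma gain_diff: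
  assumes "p \<le> q"
  shows "gain F (q - x) - gain F (p - x) = (LINT P|restrict_space lborel {p<..<q}. F (P - x))"
proof -
  have "(LBINT P=p..q. F (P - x)) = gain F (q - x) - gain F (p - x)"
  proof (rule interval_integral_FTC_finite)
    show "continuous_on {min p q..max p q} (\<lambda>P. F (P - x))"
      by (intro continuous_on_compose2[OF F_cont] continuous_intros) auto
    show "((\<lambda>P. gain F (P - x)) has_vector_derivative F (P - x)) (at P within {min p q..max p q})" for P
    proof -
      have "((\<lambda>P. gain F (P - x)) has_real_derivative F (P - x) * 1) (at P)"
        by (rule DERIV_chain2[OF gain_DERIV]) (auto intro!: derivative_eq_intros)
      then show ?thesis
        unfolding has_real_derivative_iff_has_vector_derivative
        by (auto intro: has_vector_derivative_at_within)
    qed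
  qed
  moreover have "(LBINT P=p..q. F (P - x)) = (LINT P|restrict_space lborel {p<..<q}. F (P - x))"
    using assms by (simp add: interval_integral_Ioo integral_restrict_space set_lebesgue_integral_def)
  ultimately show ?thesis by simp
qed

text \<open>Fubini on a product of two finite measures, where the integrand is bounded by 1: a
  difference of aggregate gains is the aggregate supply integrated over the prices in
  between.\<close>

lemma gain_diff_integral:
  assumes m: "finite_measure m" "sets m = sets (restrict_space borel X)" and pq: "p \<le> q"
  shows "(LINT x|m. gain F (q - x) - gain F (p - x))
      = (LINT P|restrict_space lborel {p<..<q}. LINT x|m. F (P - x))"
    and "integrable (restrict_space lborel {p<..<q}) (\<lambda>P. LINT x|m. F (P - x))"
proof -
  let ?N = "restrict_space lborel {p<..<q}"
  interpret m: finite_measure m by fact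
  interpret N: finite_measure ?N
    by (rule finite_measureI) (simp only: emeasure_restrict_lborel[OF pq], simp)
  interpret pair_sigma_finite ?N m ..
  interpret Nm: finite_measure "?N \<Otimes>\<^sub>M m"
    by (rule finite_measure_pair_measure) unfold_locales
  have "(\<lambda>x. x) \<in> borel_measurable (restrict_space borel X)"
    by (rule measurable_restrict_space1) simp
  then have [measurable]: "(\<lambda>x. x) \<in> borel_measurable m"
    by (simp only: measurable_cong_sets[OF m(2) refl])
  have [measurable]: "(\<lambda>x. x) \<in> borel_measurable ?N"
    by (rule measurable_restrict_space1) simp
  have meas: "(\<lambda>(P, x). F (P - x)) \<in> borel_measurable (?N \<Otimes>\<^sub>M m)" by measurable
  have int: "integrable (?N \<Otimes>\<^sub>M m) (\<lambda>(P, x). F (P - x))"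
    using meas F_abs by (intro Nm.integrable_const_bound[where B=1]) auto
  show "(LINT x|m. gain F (q - x) - gain F (p - x)) = (LINT P|?N. LINT x|m. F (P - x))"
    unfolding gain_diff[OF pq] using Fubini_integral[OF int] .
  show "integrable ?N (\<lambda>P. LINT x|m. F (P - x))"
    using integrable_fst'[OF int] by simp
qed

text \<open>The gap in supply is integrated over the prices between \<open>p\<close> and
  \<open>q\<close>. The inequality stays strict because this interval has positive length.\<close>

lemma gain_gap_less:
  assumes "finite_measure m1" "sets m1 = sets (restrict_space borel X)"
    and "finite_measure m2" "sets m2 = sets (restrict_space borel X)"
    and "p < q"
    and gap: "\<And>P. p < P \<Longrightarrow> P < q \<Longrightarrow> (LINT x|m1. F (P - x)) - (LINT x|m2. F (P - x)) < r"
  shows "(LINT x|m1. gain F (q - x) - gain F (p - x)) - (LINT x|m2. gain F (q - x) - gain F (p - x))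
     < r * (q - p)"
proof -
  let ?N = "restrict_space lborel {p<..<q}"
  have pq: "p \<le> q" using \<open>p < q\<close> by simp
  note e = emeasure_restrict_lborel[OF pq]
  interpret N: finite_measure ?N by (rule finite_measureI) (simp only: e, simp)
  note i = gain_diff_integral[OF assms(1,2) pq] gain_diff_integral[OF assms(3,4) pq]
  have "(LINT P|?N. (LINT x|m1. F (P - x)) - (LINT x|m2. F (P - x))) < (LINT P|?N. r)"
  proof (rule N.integral_less_AE_space)
    show "AE P in ?N. (LINT x|m1. F (P - x)) - (LINT x|m2. F (P - x)) < r"
      using gap by (intro AE_I2) (simp add: space_restrict_space)
    show "emeasure ?N (space ?N) \<noteq> 0" using \<open>p < q\<close> unfolding e by simp
  qed (use i in simp_all)
  also have "(LINT P|?N. r) = r * (q - p)"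
    using pq e unfolding lebesgue_integral_const measure_def by simp
  finally show ?thesis by (simp add: i)
qed

section \<open>Measurability of the price in time and comparison of two prices\<close>

lemma supply_mono:
  assumes "positive_flow T X \<omega>" "t \<in> {0..T}" "p \<le> q"
  shows "(LINT x|\<omega> t. F (p - x)) \<le> (LINT x|\<omega> t. F (q - x))"
proof (rule integral_mono)
  have [measurable]: "(\<lambda>x. x) \<in> borel_measurable (restrict_space borel X)"
    by (rule measurable_restrict_space1) simp
  have "integrable (\<omega> t) (\<lambda>x. F (a - x))" for a
    by (rule positive_flow_integrable[OF assms(1,2) _ F_abs]) measurable
  then show "integrable (\<omega> t) (\<lambda>x. F (p - x))" and "integrable (\<omega> t) (\<lambda>x. F (q - x))" by this+
  show "F (p - x) \<le> F (q - x)" for x using assms(3) by (intro monoD[OF F_mono]) simp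
qed

text \<open>Supply increases with the price, so a market-clearing price below \<open>a\<close> can
  be raised to a rational one that is still below \<open>a\<close>. The event that the price is
  below \<open>a\<close> is therefore a countable union of measurable sets.\<close>

lemma price_measurable:
  assumes "0 \<le> Pbar" and \<omega>: "positive_flow T {0..} \<omega>" and \<eta>: "positive_flow T {0..1} \<eta>"
    and D[measurable]: "D \<in> borel_measurable (lebesgue_on {0..T})"
    and mean: "continuous_on {0..T} (\<lambda>t. LINT x|\<eta>bar t. x)"
    and F0: "mono_on {0..} F0"
  shows "(\<lambda>t. price Pbar D \<eta>bar F F0 t (\<omega> t) (\<eta> t)) \<in> borel_measurable (lebesgue_on {0..T})"
proof -
  let ?L = "lebesgue_on {0..T}"
  define d where "d t = max (D t - renewable_output (\<eta>bar t) (\<eta> t)) 0" for t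
  define Q where "Q t P = (LINT x|\<omega> t. F (P - x)) + F0 P" for t P
  have [measurable]: "(\<lambda>t. LINT x|\<eta>bar t. x) \<in> borel_measurable ?L"
    using mean by (rule continuous_imp_measurable_on_sets_lebesgue) simp
  have [measurable]: "(\<lambda>t. LINT x|\<eta> t. x) \<in> borel_measurable ?L"
    by (rule positive_flow_integral_measurable[OF \<eta>, where B=1]) (simp_all add: case_prod_beta' snd_borel_measurable)
  have [measurable]: "d \<in> borel_measurable ?L"
    unfolding d_def renewable_output_def by measurable
  have [measurable]: "(\<lambda>t. LINT x|\<omega> t. F (P - x)) \<in> borel_measurable ?L" for P
  proof (rule positive_flow_integral_measurable[OF \<omega> _ F_abs])
    have "(\<lambda>z. F (P - snd z)) \<in> borel_measurable (?L \<Otimes>\<^sub>M restrict_space borel {0..})"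
      by (rule measurable_compose[OF snd_borel_measurable]) measurable
    then show "(\<lambda>(t, x). F (P - x)) \<in> borel_measurable (?L \<Otimes>\<^sub>M restrict_space borel {0..})"
      by (simp add: case_prod_beta')
  qed simp
  have [measurable]: "(\<lambda>t. Q t P) \<in> borel_measurable ?L" for P
    unfolding Q_def by measurable
  have eq: "price Pbar D \<eta>bar F F0 t (\<omega> t) (\<eta> t) < a \<longleftrightarrow>
      Pbar < a \<or> (\<exists>q\<in>\<rat> \<inter> {0..<a}. d t \<le> Q t q)" if t: "t \<in> {0..T}" for t a
  proof -
    have "\<exists>q\<in>\<rat> \<inter> {0..<a}. d t \<le> Q t q" if P: "0 \<le> P" "P < a" "d t \<le> Q t P" for P
    proof -
      obtain q where q: "q \<in> \<rat>" "P < q" "q < a" using Rats_dense_in_real[OF P(2)] by auto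
      have "Q t P \<le> Q t q"
        unfolding Q_def using supply_mono[OF \<omega> t, of P q] P(1) q(2) mono_onD[OF F0, of P q] by simp
      with P q show ?thesis by (intro bexI[of _ q]) auto
    qed
    moreover have "\<exists>P. 0 \<le> P \<and> P < a \<and> d t \<le> Q t P" if "\<exists>q\<in>\<rat> \<inter> {0..<a}. d t \<le> Q t q"
      using that by auto
    ultimately show ?thesis
      unfolding price_less_iff[OF assms(1)] d_def[symmetric] Q_def[symmetric] by blast
  qed
  show ?thesis
  proof (subst borel_measurable_iff_less, intro allI)
    fix a
    have "{t \<in> space ?L. Pbar < a \<or> (\<exists>q\<in>\<rat> \<inter> {0..<a}. d t \<le> Q t q)} \<in> sets ?L"
    proof -
      have "{t \<in> space ?L. d t \<le> Q t q} \<in> sets ?L" for q by measurable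
      then have "(\<Union>q\<in>\<rat> \<inter> {0..<a}. {t \<in> space ?L. d t \<le> Q t q}) \<in> sets ?L"
        by (intro sets.countable_UN'' countable_Int1 countable_rat)
      moreover have "{t \<in> space ?L. Pbar < a \<or> (\<exists>q\<in>\<rat> \<inter> {0..<a}. d t \<le> Q t q)} =
        (if Pbar < a then space ?L else (\<Union>q\<in>\<rat> \<inter> {0..<a}. {t \<in> space ?L. d t \<le> Q t q}))"
        by auto
      ultimately show ?thesis by (cases "Pbar < a") simp_all
    qed
    also have "{t \<in> space ?L. Pbar < a \<or> (\<exists>q\<in>\<rat> \<inter> {0..<a}. d t \<le> Q t q)} =
        {t \<in> space ?L. price Pbar D \<eta>bar F F0 t (\<omega> t) (\<eta> t) < a}"
      by (intro Collect_cong conj_cong refl eq[symmetric]) simp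
    finally show "{t \<in> space ?L. price Pbar D \<eta>bar F F0 t (\<omega> t) (\<eta> t) < a} \<in> sets ?L" .
  qed
qed

text \<open>The pointwise source of uniqueness: at equal prices between \<open>p2\<close> and
  \<open>p1\<close>, the first market supplies less conventional power relative to the second than
  the difference in renewable terms would balance. \<open>gain_gap_less\<close> integrates this over
  the price.\<close>

lemma price_gap:
  assumes Pbar: "0 \<le> Pbar" and \<omega>: "positive_flow T {0..} \<omega>1" "positive_flow T {0..} \<omega>2"
    and F0: "mono_on {0..} F0" "\<And>p. 0 \<le> p \<Longrightarrow> 0 \<le> F0 p"
    and t: "t \<in> {0..T}"
    and p1: "p1 = price Pbar D \<eta>bar F F0 t (\<omega>1 t) \<eta>1"
    and p2: "p2 = price Pbar D \<eta>bar F F0 t (\<omega>2 t) \<eta>2"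
    and less: "p2 < p1"
  shows "(LINT x|\<omega>1 t. gain F (p1 - x) - gain F (p2 - x)) - (LINT x|\<omega>2 t. gain F (p1 - x) - gain F (p2 - x))
     < ((LINT x|\<eta>1. x) - (LINT x|\<eta>2. x)) * (p1 - p2)"
proof (rule gain_gap_less[OF positive_flowD(1,2)[OF \<omega>(1) t] positive_flowD(1,2)[OF \<omega>(2) t] less])
  fix P assume P: "p2 < P" "P < p1"
  have P0: "0 \<le> P" and PP: "P < Pbar"
    using price_bounds(1)[OF Pbar, of D \<eta>bar F F0 t "\<omega>2 t" "\<eta>2"] P
      price_bounds(2)[OF Pbar, of D \<eta>bar F F0 t "\<omega>1 t" "\<eta>1"]
    unfolding p1[symmetric] p2[symmetric] by linarith+
  \<comment> \<open>Since \<open>P\<close> is below the cap, \<open>p2 < P\<close> cannot be due to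
    the cap and must come from a price that clears the second market. Monotone supply carries
    clearing up to \<open>P\<close>.\<close>
  from P(1) PP obtain P' where P': "0 \<le> P'" "P' < P"
    "max (D t - renewable_output (\<eta>bar t) \<eta>2) 0 \<le> (LINT x|\<omega>2 t. F (P' - x)) + F0 P'"
    unfolding p2 price_less_iff[OF Pbar] by auto
  have "(LINT x|\<omega>2 t. F (P' - x)) + F0 P' \<le> (LINT x|\<omega>2 t. F (P - x)) + F0 P"
    using supply_mono[OF \<omega>(2) t, of P' P] mono_onD[OF F0(1), of P' P] P' P0 by simp
  with P' have 2: "D t - renewable_output (\<eta>bar t) \<eta>2 \<le> (LINT x|\<omega>2 t. F (P - x)) + F0 P"
    by simp
  \<comment> \<open>Clearing the first market at \<open>P\<close>, which is below \<open>p1\<close>,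
    would push the infimum below \<open>p1\<close> itself.\<close>
  have "\<not> max (D t - renewable_output (\<eta>bar t) \<eta>1) 0 \<le> (LINT x|\<omega>1 t. F (P - x)) + F0 P"
  proof
    assume "max (D t - renewable_output (\<eta>bar t) \<eta>1) 0 \<le> (LINT x|\<omega>1 t. F (P - x)) + F0 P"
    with P0 P(2) have "p1 < p1" unfolding p1 by (subst price_less_iff[OF Pbar]) auto
    then show False by simp
  qed
  \<comment> \<open>Supply is nonnegative, so if it falls short of the positive part of residual
    demand, it falls short of residual demand itself.\<close>
  moreover have "0 \<le> (LINT x|\<omega>1 t. F (P - x)) + F0 P"
    using F0(2)[OF P0] F_nonneg by (intro add_nonneg_nonneg Bochner_Integration.integral_nonneg) auto
  ultimately have "(LINT x|\<omega>1 t. F (P - x)) + F0 P < D t - renewable_output (\<eta>bar t) \<eta>1"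
    by auto
  with 2 show "(LINT x|\<omega>1 t. F (P - x)) - (LINT x|\<omega>2 t. F (P - x)) < (LINT x|\<eta>1. x) - (LINT x|\<eta>2. x)"
    unfolding renewable_output_def by simp
qed

end

section \<open>Uniqueness of the price\<close>

lemma id_borel_measurable_lebesgue_on: "(\<lambda>t. t) \<in> borel_measurable (lebesgue_on {0..T::real})"
  by (rule continuous_imp_measurable_on_sets_lebesgue) (auto intro: continuous_intros)

lemma exp_discount_le_1:
  assumes "0 \<le> (r::real)" "0 \<le> t" shows "exp (- r * t) \<le> 1"
  using assms by simp

lemma f_C_abs:
  assumes "0 < \<rho>" "0 \<le> \<kappa>" "0 \<le> K" "0 \<le> \<gamma>" "0 \<le> t"
  shows "\<bar>f_C \<rho> \<kappa> K \<gamma> t\<bar> \<le> \<kappa> + K * (\<rho> + \<gamma>)"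
proof -
  have "exp (- \<gamma> * t) * (K * (\<rho> + \<gamma>)) \<le> 1 * (K * (\<rho> + \<gamma>))"
    using assms by (intro mult_right_mono exp_discount_le_1) auto
  moreover have "0 \<le> exp (- \<gamma> * t) * (K * (\<rho> + \<gamma>))" "0 \<le> K * (\<rho> + \<gamma>)" using assms by simp_all
  ultimately have "\<bar>- \<kappa> - exp (- \<gamma> * t) * (K * (\<rho> + \<gamma>))\<bar> \<le> \<kappa> + K * (\<rho> + \<gamma>)"
    using assms(2) by linarith
  then show ?thesis by (simp add: f_C_def mult.assoc)
qed

lemma f_R_abs:
  assumes "0 < \<rho>" "0 \<le> \<kappa>" "0 \<le> K" "0 \<le> \<gamma>" "t \<le> T"
  shows "\<bar>f_R T \<rho> \<kappa> K \<gamma> t\<bar> \<le> \<kappa> + \<rho> * K + \<gamma> * K"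
proof -
  have "exp (- (\<rho> + \<gamma>) * (T - t)) * (\<gamma> * K) \<le> 1 * (\<gamma> * K)"
    using assms by (intro mult_right_mono exp_discount_le_1) auto
  moreover have "0 \<le> exp (- (\<rho> + \<gamma>) * (T - t)) * (\<gamma> * K)" using assms by simp
  moreover have "0 \<le> \<rho> * K" using assms by simp
  ultimately show ?thesis using assms by (simp add: f_R_def mult.commute[of "\<gamma> * K"] abs_le_iff)
qed

lemma f_C_measurable: "f_C \<rho> \<kappa> K \<gamma> \<in> borel_measurable (lebesgue_on {0..T})"
  unfolding f_C_def
  by (rule continuous_imp_measurable_on_sets_lebesgue) (auto intro!: continuous_intros)

lemma f_R_measurable: "f_R T \<rho> \<kappa> K \<gamma> \<in> borel_measurable (lebesgue_on {0..T})"
  unfolding f_R_def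
  by (rule continuous_imp_measurable_on_sets_lebesgue) (auto intro!: continuous_intros)

context bounded_supply
begin

text \<open>Stated for an arbitrary price path, so that each flow can also be evaluated at the other
  equilibrium's prices. The closed form separates the fixed term, which sees only the mass of
  \<open>\<omega> t\<close> and will cancel between the two equilibria.\<close>

lemma conventional_payoff:
  assumes \<omega>: "positive_flow T {0..} \<omega>" and "0 < \<rho>"
    and p[measurable]: "p \<in> borel_measurable (lebesgue_on {0..T})"
    and bound: "\<And>t. p t \<le> Pbar"
    and f[measurable]: "f \<in> borel_measurable (lebesgue_on {0..T})"
    and fB: "\<And>t. t \<in> {0..T} \<Longrightarrow> \<bar>f t\<bar> \<le> B"
  shows "integrable (lebesgue_on {0..T}) (\<lambda>t. LINT x|\<omega> t. exp (- \<rho> * t) * (gain F (p t - x) + f t))"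
    and "\<And>t. t \<in> {0..T} \<Longrightarrow> integrable (\<omega> t) (\<lambda>x. gain F (p t - x))"
    and "\<And>t. t \<in> {0..T} \<Longrightarrow> (LINT x|\<omega> t. exp (- \<rho> * t) * (gain F (p t - x) + f t)) =
      exp (- \<rho> * t) * ((LINT x|\<omega> t. gain F (p t - x)) + f t * measure (\<omega> t) (space (\<omega> t)))"
proof -
  let ?L = "lebesgue_on {0..T}" and ?B = "restrict_space borel {0..}"
  note [measurable] = snd_borel_measurable id_borel_measurable_lebesgue_on
  have G: "\<bar>gain F (p t - x)\<bar> \<le> gain F Pbar" if "0 \<le> x" for t x
    using gain_mono[of "p t - x" Pbar] bound[of t] that gain_nonneg[of "p t - x"] by simp
  show "integrable ?L (\<lambda>t. LINT x|\<omega> t. exp (- \<rho> * t) * (gain F (p t - x) + f t))"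
  proof (rule positive_flow_integral_integrable[OF \<omega>])
    show "(\<lambda>(t, x). exp (- \<rho> * t) * (gain F (p t - x) + f t)) \<in> borel_measurable (?L \<Otimes>\<^sub>M ?B)"
      unfolding case_prod_beta' by measurable
    fix t x assume t: "t \<in> {0..T}" and x: "x \<in> {0::real..}"
    have "\<bar>exp (- \<rho> * t) * (gain F (p t - x) + f t)\<bar> = exp (- \<rho> * t) * \<bar>gain F (p t - x) + f t\<bar>"
      by (simp add: abs_mult)
    also have "\<dots> \<le> 1 * \<bar>gain F (p t - x) + f t\<bar>"
      using t \<open>0 < \<rho>\<close> by (intro mult_right_mono exp_discount_le_1) auto
    also have "\<dots> \<le> gain F Pbar + B" using G[of x t] fB[OF t] x by simp
    finally show "\<bar>exp (- \<rho> * t) * (gain F (p t - x) + f t)\<bar> \<le> gain F Pbar + B" .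
  qed simp
  fix t assume t: "t \<in> {0..T}"
  interpret finite_measure "\<omega> t" by (rule positive_flowD(1)[OF \<omega> t])
  have id: "(\<lambda>x. x) \<in> borel_measurable ?B" by (rule measurable_restrict_space1) simp
  show i: "integrable (\<omega> t) (\<lambda>x. gain F (p t - x))"
  proof (rule positive_flow_integrable[OF \<omega> t])
    show "(\<lambda>x. gain F (p t - x)) \<in> borel_measurable ?B" using id by measurable
  qed (use G in auto)
  then show "(LINT x|\<omega> t. exp (- \<rho> * t) * (gain F (p t - x) + f t)) =
      exp (- \<rho> * t) * ((LINT x|\<omega> t. gain F (p t - x)) + f t * measure (\<omega> t) (space (\<omega> t)))"
    by (simp add: Bochner_Integration.integral_add mult.commute[of "f t"])
qed

text \<open>The counterpart for the renewable side; here the payoff is bounded because both the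
  price and the output \<open>x\<close> range over bounded intervals.\<close>

lemma renewable_payoff:
  assumes \<eta>: "positive_flow T {0..1} \<eta>" and "0 < \<rho>"
    and p[measurable]: "p \<in> borel_measurable (lebesgue_on {0..T})"
    and bound: "\<And>t. 0 \<le> p t" "\<And>t. p t \<le> Pbar"
    and f[measurable]: "f \<in> borel_measurable (lebesgue_on {0..T})"
    and fB: "\<And>t. t \<in> {0..T} \<Longrightarrow> \<bar>f t\<bar> \<le> B"
  shows "integrable (lebesgue_on {0..T}) (\<lambda>t. LINT x|\<eta> t. exp (- \<rho> * t) * (- p t * x + f t))"
    and "\<And>t. t \<in> {0..T} \<Longrightarrow> (LINT x|\<eta> t. exp (- \<rho> * t) * (- p t * x + f t)) =
      exp (- \<rho> * t) * (- p t * (LINT x|\<eta> t. x) + f t * measure (\<eta> t) (space (\<eta> t)))"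
proof -
  let ?L = "lebesgue_on {0..T}" and ?B = "restrict_space borel {0..1}"
  note [measurable] = snd_borel_measurable id_borel_measurable_lebesgue_on
  show "integrable ?L (\<lambda>t. LINT x|\<eta> t. exp (- \<rho> * t) * (- p t * x + f t))"
  proof (rule positive_flow_integral_integrable[OF \<eta>])
    show "(\<lambda>(t, x). exp (- \<rho> * t) * (- p t * x + f t)) \<in> borel_measurable (?L \<Otimes>\<^sub>M ?B)"
      unfolding case_prod_beta' by measurable
    fix t x assume t: "t \<in> {0..T}" and x: "x \<in> {0..1::real}"
    have "0 \<le> Pbar" using bound[of t] by linarith
    then have "0 \<le> p t * x" "p t * x \<le> Pbar * 1"
      using bound[of t] x mult_mono[of "p t" Pbar x 1] by simp_all
    then have px: "\<bar>- p t * x + f t\<bar> \<le> Pbar + B" using fB[OF t] by (simp add: abs_le_iff)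
    have "\<bar>exp (- \<rho> * t) * (- p t * x + f t)\<bar> = exp (- \<rho> * t) * \<bar>- p t * x + f t\<bar>"
      by (simp add: abs_mult)
    also have "\<dots> \<le> 1 * \<bar>- p t * x + f t\<bar>"
      using t \<open>0 < \<rho>\<close> by (intro mult_right_mono exp_discount_le_1) auto
    finally show "\<bar>exp (- \<rho> * t) * (- p t * x + f t)\<bar> \<le> Pbar + B" using px by simp
  qed simp
  fix t assume t: "t \<in> {0..T}"
  interpret finite_measure "\<eta> t" by (rule positive_flowD(1)[OF \<eta> t])
  have id: "(\<lambda>x. x) \<in> borel_measurable ?B" by (rule measurable_restrict_space1) simp
  have i: "integrable (\<eta> t) (\<lambda>x. x)"
    by (rule positive_flow_integrable[OF \<eta> t id, of 1]) simp
  then show "(LINT x|\<eta> t. exp (- \<rho> * t) * (- p t * x + f t)) =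
      exp (- \<rho> * t) * (- p t * (LINT x|\<eta> t. x) + f t * measure (\<eta> t) (space (\<eta> t)))"
    by (simp add: Bochner_Integration.integral_diff mult.commute[of "f t"])
qed

end

text \<open>Continuity is the lowest level of smoothness. The bounds follow from monotonicity by
  comparing \<open>y\<close> with a point at most 0 and a point at least \<open>c 1\<close>, where
  the value is explicit.\<close>

lemma bounded_supply_supply_curve:
  assumes "c 0 = 0" "strict_mono_on {0..1} c" "smooth_on_open UNIV (supply_curve c)" "mono (supply_curve c)"
  shows "bounded_supply (supply_curve c)"
proof
  have c1: "0 < c 1" using strict_mono_onD[OF assms(2), of 0 1] assms(1) by simp
  have neg: "supply_curve c y = 0" if "y \<le> 0" for y using that by (simp add: supply_curve_def)
  show "continuous_on UNIV (supply_curve c)"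
  proof (rule differentiable_imp_continuous_on)
    have "(deriv ^^ 0) (supply_curve c) differentiable (at x)" for x
      using assms(3) unfolding smooth_on_open_def by blast
    then show "supply_curve c differentiable_on UNIV"
      by (simp add: differentiable_on_def)
  qed
  fix y
  show "y \<le> 0 \<Longrightarrow> supply_curve c y = 0" by (rule neg)
  show "0 \<le> supply_curve c y"
    using monoD[OF assms(4), of "min y 0" y] neg[of "min y 0"] by simp
  \<comment> \<open>Positivity of \<open>c 1\<close> rules out the first branch of
    \<open>supply_curve\<close> at this point.\<close>
  have "supply_curve c (max y (c 1)) = 1" using c1 by (auto simp: supply_curve_def max_def)
  then show "supply_curve c y \<le> 1"
    using monoD[OF assms(4), of y "max y (c 1)"] by simp
qed fact

lemma jacobi_process_measurable:
  assumes "jacobi_process T k \<theta> \<delta> M Fl W x X" "subalgebra M (Fl t)" "t \<in> {0..T}"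
  shows "X t \<in> M \<rightarrow>\<^sub>M restrict_space borel {0..1}"
proof (rule measurable_restrict_space2)
  show "X t \<in> borel_measurable M"
    using assms by (intro measurable_from_subalg[OF assms(2)]) (auto simp: jacobi_process_def)
  show "X t \<in> space M \<rightarrow> {0..1}"
    using assms(1,3) unfolding jacobi_process_def by blast
qed

lemma admissible_flows_positive: "m \<in> admissible_flows T X L m0 \<Longrightarrow> positive_flow T X m"
  unfolding admissible_flows_def by (elim CollectE conjE)

theorem proposition2:
  fixes T \<rho> Pbar k \<theta> \<delta> kbar \<theta>bar \<delta>bar \<kappa>C KC \<gamma>C \<kappa>R KR \<gamma>R c0 :: real
    and D c F G F0 :: "real \<Rightarrow> real"
    and \<omega>0 \<eta>0 :: "real measure"
    and M :: "'w measure" and Fl :: "real \<Rightarrow> 'w measure" and W :: "real \<Rightarrow> 'w \<Rightarrow> real"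
    and S :: "real \<Rightarrow> real \<Rightarrow> 'w \<Rightarrow> real"
    and \<eta>bar \<omega>1 \<eta>1 \<omega>2 \<eta>2 :: "real \<Rightarrow> real measure"
    and \<A> \<A>bar :: "(real \<Rightarrow> real measure) set"
    and P :: "real \<Rightarrow> real measure \<Rightarrow> real measure \<Rightarrow> real"
  assumes "T > 0" "\<rho> > 0" "Pbar > 0"
    and "k > 0" "\<theta> > 0" "\<delta> > 0"
    and "kbar > 0" "\<delta>bar > 0" "0 < \<theta>bar" "\<theta>bar < 1"
    and "\<kappa>C \<ge> 0" "KC \<ge> 0" "\<gamma>C \<ge> 0" "\<kappa>R \<ge> 0" "KR \<ge> 0" "\<gamma>R \<ge> 0"
    and "D \<in> borel_measurable (lebesgue_on {0..T})"
    and "finite_measure \<omega>0" "sets \<omega>0 = sets (restrict_space borel {0..})"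
    and "finite_measure \<eta>0" "sets \<eta>0 = sets (restrict_space borel {0..1})"
    and "brownian_motion M Fl W"
    and "\<forall>x\<in>{0..1}. jacobi_process T kbar \<theta>bar \<delta>bar M Fl W x (S x)"
    and "output_distribution T M S \<eta>0 \<eta>bar"
    and "strict_mono_on {0..1} c" "continuous_on {0..1} c" "c 0 = 0" "smooth_on_open {0<..<1} c"
    and "F = supply_curve c" "smooth_on_open UNIV F" "mono F" "\<forall>y>0. F y > 0"
    and "G = gain F"
    and "\<forall>p\<ge>0. F0 p \<ge> 0" "mono_on {0..} F0" "F0 0 = 0"
    and "c0 > 0" "\<forall>p\<ge>0. \<forall>h\<ge>0. F0 (p + h) - F0 p \<ge> c0 * h"
    and "\<A> = admissible_flows T {0..} (cir_generator k \<theta> \<delta>) \<omega>0"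
    and "\<A>bar = admissible_flows T {0..1} (jacobi_generator kbar \<theta>bar \<delta>bar) \<eta>0"
    and "P = price Pbar D \<eta>bar F F0"
    and "nash_equilibrium T \<rho> \<A> \<A>bar G (f_C \<rho> \<kappa>C KC \<gamma>C) (f_R T \<rho> \<kappa>R KR \<gamma>R) P \<omega>1 \<eta>1"
    and "nash_equilibrium T \<rho> \<A> \<A>bar G (f_C \<rho> \<kappa>C KC \<gamma>C) (f_R T \<rho> \<kappa>R KR \<gamma>R) P \<omega>2 \<eta>2"
  shows "{t \<in> {0..T}. P t (\<omega>1 t) (\<eta>1 t) \<noteq> P t (\<omega>2 t) (\<eta>2 t)} \<in> null_sets lebesgue"
proof -
  define fC where "fC = f_C \<rho> \<kappa>C KC \<gamma>C"
  define fR where "fR = f_R T \<rho> \<kappa>R KR \<gamma>R"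
  let ?L = "lebesgue_on {0..T}"
  have Pbar: "0 \<le> Pbar" and \<rho>: "0 < \<rho>" using \<open>Pbar > 0\<close> \<open>\<rho> > 0\<close> by simp_all
  have "F = supply_curve c" by fact
  note F = bounded_supply_supply_curve[of c, folded this]
  interpret bounded_supply F by (rule F) fact+
  have G: "G = gain F" by fact
  have P: "P = price Pbar D \<eta>bar F F0" by fact
  have mean: "continuous_on {0..T} (\<lambda>t. LINT x|\<eta>bar t. x)"
  proof (rule output_mean_continuous[where M=M and S=S])
    show "prob_space M" using \<open>brownian_motion M Fl W\<close> by (simp add: brownian_motion_def)
    fix x :: real assume x: "x \<in> {0..1}"
    then have J: "jacobi_process T kbar \<theta>bar \<delta>bar M Fl W x (S x)"
      using \<open>\<forall>x\<in>{0..1}. jacobi_process T kbar \<theta>bar \<delta>bar M Fl W x (S x)\<close> by (rule bspec[rotated])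
    show "S x t \<in> M \<rightarrow>\<^sub>M restrict_space borel {0..1}" if "t \<in> {0..T}" for t
      using \<open>brownian_motion M Fl W\<close> that
      by (intro jacobi_process_measurable[OF J]) (auto simp: brownian_motion_def)
    show "continuous_on {0..T} (\<lambda>t. S x t w)" if "w \<in> space M" for w
      using J that unfolding jacobi_process_def by blast
  qed fact+
  have nash: "nash_equilibrium T \<rho> \<A> \<A>bar (gain F) fC fR P \<omega>1 \<eta>1"
      "nash_equilibrium T \<rho> \<A> \<A>bar (gain F) fC fR P \<omega>2 \<eta>2"
    unfolding fC_def fR_def G[symmetric] by fact+
  note nash' = nash[unfolded nash_equilibrium_def]
  note mem = nash'(1)[THEN conjunct1] nash'(2)[THEN conjunct1]
    nash'(1)[THEN conjunct2, THEN conjunct1] nash'(2)[THEN conjunct2, THEN conjunct1]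
  have flows: "positive_flow T {0..} \<omega>1" "positive_flow T {0..} \<omega>2"
      "positive_flow T {0..1} \<eta>1" "positive_flow T {0..1} \<eta>2"
    using mem unfolding \<open>\<A> = _\<close> \<open>\<A>bar = _\<close> by (auto intro: admissible_flows_positive)
  define p1 where "p1 t = P t (\<omega>1 t) (\<eta>1 t)" for t
  define p2 where "p2 t = P t (\<omega>2 t) (\<eta>2 t)" for t
  have bounds: "0 \<le> p1 t" "p1 t \<le> Pbar" "0 \<le> p2 t" "p2 t \<le> Pbar" for t
    unfolding p1_def p2_def P using price_bounds[OF Pbar] by simp_all
  have meas: "p1 \<in> borel_measurable ?L" "p2 \<in> borel_measurable ?L"
    unfolding p1_def p2_def P
    by (rule price_measurable[OF Pbar flows(1,3) _ mean] price_measurable[OF Pbar flows(2,4) _ mean]; fact)+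
  have fCm: "fC \<in> borel_measurable ?L" and fRm: "fR \<in> borel_measurable ?L"
    unfolding fC_def fR_def by (rule f_C_measurable f_R_measurable)+
  have fCB: "\<bar>fC t\<bar> \<le> \<kappa>C + KC * (\<rho> + \<gamma>C)" and fRB: "\<bar>fR t\<bar> \<le> \<kappa>R + \<rho> * KR + \<gamma>R * KR"
    if "t \<in> {0..T}" for t
  proof -
    from that have "0 \<le> t" "t \<le> T" by auto
    show "\<bar>fC t\<bar> \<le> \<kappa>C + KC * (\<rho> + \<gamma>C)" unfolding fC_def by (rule f_C_abs) fact+
    show "\<bar>fR t\<bar> \<le> \<kappa>R + \<rho> * KR + \<gamma>R * KR" unfolding fR_def by (rule f_R_abs) fact+
  qed
  \<comment> \<open>The price path and the flow are separate arguments, because all four pairings of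
    the two equilibria occur; \<open>b\<close> below is the renewable analogue.\<close>
  define a where "a p \<omega> t = (LINT x|\<omega> t. exp (- \<rho> * t) * (gain F (p t - x) + fC t))"
    for p :: "real \<Rightarrow> real" and \<omega> :: "real \<Rightarrow> real measure" and t
  define b where "b p \<eta> t = (LINT x|\<eta> t. exp (- \<rho> * t) * (- p t * x + fR t))"
    for p :: "real \<Rightarrow> real" and \<eta> :: "real \<Rightarrow> real measure" and t
  define ok where "ok p \<longleftrightarrow> p \<in> borel_measurable ?L \<and> (\<forall>t. 0 \<le> p t \<and> p t \<le> Pbar)" for p :: "real \<Rightarrow> real"
  have ok: "ok p1" "ok p2" using bounds meas by (simp_all add: ok_def)
  have a_int: "integrable ?L (a p \<omega>)" if "ok p" "positive_flow T {0..} \<omega>" for p \<omega>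
    unfolding a_def
    by (rule conventional_payoff(1)[where Pbar=Pbar, OF that(2) \<rho> _ _ fCm fCB]) (use that(1) in \<open>simp_all add: ok_def\<close>)
  have b_int: "integrable ?L (b p \<eta>)" if "ok p" "positive_flow T {0..1} \<eta>" for p \<eta>
    unfolding b_def
    by (rule renewable_payoff(1)[where Pbar=Pbar, OF that(2) \<rho> _ _ _ fRm fRB]) (use that(1) in \<open>simp_all add: ok_def\<close>)
  note ai = a_int[OF ok(1) flows(1)] a_int[OF ok(1) flows(2)] a_int[OF ok(2) flows(1)] a_int[OF ok(2) flows(2)]
  note bi = b_int[OF ok(1) flows(3)] b_int[OF ok(1) flows(4)] b_int[OF ok(2) flows(3)] b_int[OF ok(2) flows(4)]
  \<comment> \<open>Both equilibria share the same admissible sets, so the flow of each is a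
    legitimate deviation in the other.\<close>
  have opt: "integral\<^sup>L ?L (a p1 \<omega>2) \<le> integral\<^sup>L ?L (a p1 \<omega>1)"
      "integral\<^sup>L ?L (a p2 \<omega>1) \<le> integral\<^sup>L ?L (a p2 \<omega>2)"
      "integral\<^sup>L ?L (b p1 \<eta>2) \<le> integral\<^sup>L ?L (b p1 \<eta>1)"
      "integral\<^sup>L ?L (b p2 \<eta>1) \<le> integral\<^sup>L ?L (b p2 \<eta>2)"
    unfolding a_def b_def p1_def p2_def
    using nash'[THEN conjunct2, THEN conjunct2, THEN conjunct1, THEN bspec]
      nash'[THEN conjunct2, THEN conjunct2, THEN conjunct2, THEN bspec] mem by simp_all
  \<comment> \<open>Each of the four differences compares a player's own flow with a deviation at
    the same price path, so each has a nonnegative integral by \<open>opt\<close>.\<close>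
  define h where "h t = (a p1 \<omega>1 t - a p1 \<omega>2 t) + (a p2 \<omega>2 t - a p2 \<omega>1 t)
      + ((b p1 \<eta>1 t - b p1 \<eta>2 t) + (b p2 \<eta>2 t - b p2 \<eta>1 t))" for t
  have hi: "integrable ?L h"
    unfolding h_def by (intro Bochner_Integration.integrable_add Bochner_Integration.integrable_diff ai bi)
  have "integral\<^sup>L ?L h = (integral\<^sup>L ?L (a p1 \<omega>1) - integral\<^sup>L ?L (a p1 \<omega>2))
      + (integral\<^sup>L ?L (a p2 \<omega>2) - integral\<^sup>L ?L (a p2 \<omega>1))
      + ((integral\<^sup>L ?L (b p1 \<eta>1) - integral\<^sup>L ?L (b p1 \<eta>2))
      + (integral\<^sup>L ?L (b p2 \<eta>2) - integral\<^sup>L ?L (b p2 \<eta>1)))"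
    unfolding h_def by (simp add: ai bi)
  with opt have h0: "0 \<le> integral\<^sup>L ?L h" by linarith
  \<comment> \<open>The opposite sign holds pointwise, with equality only where the prices
    agree.\<close>
  have h_neg: "h t \<le> 0" "h t = 0 \<Longrightarrow> p1 t = p2 t" if t: "t \<in> {0..T}" for t
  proof -
    define g1 where "g1 \<omega> = (LINT x|\<omega> t. gain F (p1 t - x))" for \<omega> :: "real \<Rightarrow> real measure"
    define g2 where "g2 \<omega> = (LINT x|\<omega> t. gain F (p2 t - x))" for \<omega> :: "real \<Rightarrow> real measure"
    define r where "r \<eta> = (LINT x|\<eta> t. x)" for \<eta> :: "real \<Rightarrow> real measure"
    define H where "H = (g1 \<omega>1 - g2 \<omega>1) - (g1 \<omega>2 - g2 \<omega>2) - (r \<eta>1 - r \<eta>2) * (p1 t - p2 t)"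
    have aeq: "a p \<omega> t = exp (- \<rho> * t) * ((LINT x|\<omega> t. gain F (p t - x)) + fC t * measure (\<omega> t) (space (\<omega> t)))"
      and g_int: "integrable (\<omega> t) (\<lambda>x. gain F (p t - x))"
      if "ok p" "positive_flow T {0..} \<omega>" for p \<omega>
    proof -
      show "a p \<omega> t = exp (- \<rho> * t) * ((LINT x|\<omega> t. gain F (p t - x)) + fC t * measure (\<omega> t) (space (\<omega> t)))"
        unfolding a_def
        by (rule conventional_payoff(3)[where Pbar=Pbar, OF that(2) \<rho> _ _ fCm fCB t]) (use that(1) in \<open>simp_all add: ok_def\<close>)
      show "integrable (\<omega> t) (\<lambda>x. gain F (p t - x))"
        by (rule conventional_payoff(2)[where Pbar=Pbar, OF that(2) \<rho> _ _ fCm fCB t]) (use that(1) in \<open>simp_all add: ok_def\<close>)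
    qed
    have beq: "b p \<eta> t = exp (- \<rho> * t) * (- p t * r \<eta> + fR t * measure (\<eta> t) (space (\<eta> t)))"
      if "ok p" "positive_flow T {0..1} \<eta>" for p \<eta>
      unfolding b_def r_def
      by (rule renewable_payoff(2)[where Pbar=Pbar, OF that(2) \<rho> _ _ _ fRm fRB t]) (use that(1) in \<open>simp_all add: ok_def\<close>)
    \<comment> \<open>The terms with \<open>fC\<close> and \<open>fR\<close> occur with each mass
      once with either sign and cancel; what remains is the common discount factor times
      \<open>H\<close>.\<close>
    have hH: "h t = exp (- \<rho> * t) * H"
      unfolding h_def H_def g1_def g2_def
        aeq[OF ok(1) flows(1)] aeq[OF ok(1) flows(2)] aeq[OF ok(2) flows(1)] aeq[OF ok(2) flows(2)]
        beq[OF ok(1) flows(3)] beq[OF ok(1) flows(4)] beq[OF ok(2) flows(3)] beq[OF ok(2) flows(4)]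
      by (simp add: algebra_simps)
    have d12: "(LINT x|\<omega> t. gain F (p1 t - x) - gain F (p2 t - x)) = g1 \<omega> - g2 \<omega>"
      and d21: "(LINT x|\<omega> t. gain F (p2 t - x) - gain F (p1 t - x)) = g2 \<omega> - g1 \<omega>"
      if "positive_flow T {0..} \<omega>" for \<omega>
      unfolding g1_def g2_def
      by (rule Bochner_Integration.integral_diff; rule g_int[OF ok(1) that] g_int[OF ok(2) that])+
    note gap = price_gap[OF Pbar _ _ \<open>mono_on {0..} F0\<close> _ t]
    have F0: "\<And>p. 0 \<le> p \<Longrightarrow> 0 \<le> F0 p" using \<open>\<forall>p\<ge>0. F0 p \<ge> 0\<close> by simp
    have H: "H < 0" if "p1 t \<noteq> p2 t"
    proof (cases "p2 t < p1 t")
      case True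
      have "(g1 \<omega>1 - g2 \<omega>1) - (g1 \<omega>2 - g2 \<omega>2) < (r \<eta>1 - r \<eta>2) * (p1 t - p2 t)"
        using gap[OF flows(1,2) F0 p1_def[of t, unfolded P] p2_def[of t, unfolded P] True]
        unfolding d12[OF flows(1)] d12[OF flows(2)] r_def by simp
      then show ?thesis unfolding H_def by simp
    next
      case False
      \<comment> \<open>\<open>H\<close> is unchanged when the two equilibria are swapped, so the
        case of the opposite order reduces to the same gap estimate.\<close>
      with that have less: "p1 t < p2 t" by simp
      have "(g2 \<omega>2 - g1 \<omega>2) - (g2 \<omega>1 - g1 \<omega>1) < (r \<eta>2 - r \<eta>1) * (p2 t - p1 t)"
        using gap[OF flows(2,1) F0 p2_def[of t, unfolded P] p1_def[of t, unfolded P] less]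
        unfolding d21[OF flows(1)] d21[OF flows(2)] r_def by simp
      then show ?thesis unfolding H_def by (simp add: algebra_simps)
    qed
    have "H = 0" if "p1 t = p2 t" unfolding H_def g1_def g2_def using that by simp
    with H have "H \<le> 0" by (cases "p1 t = p2 t") simp_all
    then show "h t \<le> 0" unfolding hH by (intro mult_nonneg_nonpos) auto
    show "p1 t = p2 t" if "h t = 0"
    proof (rule ccontr)
      assume "p1 t \<noteq> p2 t"
      then have "H < 0" by (rule H)
      with that show False unfolding hH by simp
    qed
  qed
  have nonneg: "AE t in ?L. 0 \<le> - h t"
    using h_neg(1) by (intro AE_I2) simp
  \<comment> \<open>A nonnegative function whose integral is at most 0 has integral 0, hence
    vanishes almost everywhere.\<close>
  have "integral\<^sup>L ?L (\<lambda>t. - h t) = 0"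
    using h0 integral_nonneg_AE[OF nonneg] by simp
  then have "AE t in ?L. - h t = 0"
    using integral_nonneg_eq_0_iff_AE[OF Bochner_Integration.integrable_minus[OF hi] nonneg] by blast
  then have "AE t in ?L. p1 t = p2 t"
    using AE_space
  proof eventually_elim
    case (elim t)
    then show ?case by (intro h_neg(2)) simp_all
  qed
  \<comment> \<open>Turning the almost-everywhere statement into a null set by
    \<open>AE_iff_null\<close> requires the exceptional set itself to be measurable; this is a
    second use of the measurability of the prices.\<close>
  moreover have "{t \<in> space ?L. \<not> p1 t = p2 t} \<in> sets ?L"
    using meas by measurable
  ultimately have "{t \<in> space ?L. \<not> p1 t = p2 t} \<in> null_sets ?L"
    by (simp only: AE_iff_null)
  then have "{t \<in> {0..T}. p1 t \<noteq> p2 t} \<in> null_sets lebesgue"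
    by (subst (asm) null_sets_restrict_space) auto
  then show ?thesis unfolding p1_def p2_def .
qed

end
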